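(* Let $B\subset\mathbb{R}^2$ be the open unit disc centered at the origin, let $p\in(1,2)$, and let $u\colon B\to\mathbb{R}^2$ be given by $u(x)=x/|x|$. Then $u\in W^{1,p}(B,\mathbb{R}^2)\cap L^\infty(B,\mathbb{R}^2)$, and there exist coefficients $a\colon\mathbb{R}^2\times\mathbb{R}^{2\times2}\to\mathbb{R}^{2\times 2}$ (not depending on $x$) and constants $L\ge\nu>0$ such that, for every $\alpha\in(0,1)$, and all $u,\bar u\in\mathbb{R}^2$, $z,\lambda\in\mathbb{R}^{2\times 2}$: (i) $z\mapsto a(u,z)$ is of class $C^1$; (ii) $|a(u,z)|+|D_z a(u,z)|\,(1+|z|)\le L(1+|z|)^{p-1}$; (iii) $D_z a(u,z)\lambda\cdot\lambda\ge\nu(1+|z|)^{p-2}|\lambda|^2$; (iv) $|a(u,z)-a(\bar u,z)|\le L(1+|z|)^{p-1}\min\{1,|u-\bar u|^\alpha\}$; and such that $u$ is a weak solution of the homogeneous system $\operatorname{div} a(u,Du)=0$ in $B$, i.e. $\int_B a(u,Du)\cdot D\varphi\,dx=0$ for all $\varphi\in C^\infty_c(B,\mathbb{R}^2)$. *)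

theory Defs
  imports "HOL-Analysis.Analysis"
begin

fun Ck_on :: "nat \<Rightarrow> 'a::real_normed_vector set \<Rightarrow> ('a \<Rightarrow> 'b::real_normed_vector) \<Rightarrow> bool" where
  "Ck_on 0 S f \<longleftrightarrow> continuous_on S f"
| "Ck_on (Suc n) S f \<longleftrightarrow> (\<forall>x\<in>S. f differentiable (at x)) \<and>
      (\<forall>v. Ck_on n S (\<lambda>x. frechet_derivative f (at x) v))"

definition smooth_on :: "'a::real_normed_vector set \<Rightarrow> ('a \<Rightarrow> 'b::real_normed_vector) \<Rightarrow> bool" where
  "smooth_on S f \<longleftrightarrow> (\<forall>n. Ck_on n S f)"

definition test_fun :: "'a::euclidean_space set \<Rightarrow> ('a \<Rightarrow> 'b::real_normed_vector) \<Rightarrow> bool" where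
  "test_fun U \<phi> \<longleftrightarrow> smooth_on UNIV \<phi> \<and> compact (closure (support_on UNIV \<phi>))
     \<and> closure (support_on UNIV \<phi>) \<subseteq> U"

definition Lp_on :: "real \<Rightarrow> 'a::euclidean_space set \<Rightarrow> ('a \<Rightarrow> 'b::{real_normed_vector,second_countable_topology}) \<Rightarrow> bool" where
  "Lp_on p U f \<longleftrightarrow> set_borel_measurable lborel U f \<and> set_integrable lborel U (\<lambda>x. norm (f x) powr p)"

definition Linf_on :: "'a::euclidean_space set \<Rightarrow> ('a \<Rightarrow> 'b::{real_normed_vector,second_countable_topology}) \<Rightarrow> bool" where
  "Linf_on U f \<longleftrightarrow> set_borel_measurable lborel U f \<and> (\<exists>M. AE x in lborel. x \<in> U \<longrightarrow> norm (f x) \<le> M)"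

definition weak_jacobian :: "(real^'n) set \<Rightarrow> (real^'n \<Rightarrow> real^'m) \<Rightarrow> (real^'n \<Rightarrow> real^'n^'m) \<Rightarrow> bool" where
  "weak_jacobian U u G \<longleftrightarrow>
     (\<forall>\<phi>::real^'n \<Rightarrow> real. test_fun U \<phi> \<longrightarrow> (\<forall>i j.
        (LINT x:U|lborel. u x $ i * frechet_derivative \<phi> (at x) (axis j 1))
        = - (LINT x:U|lborel. G x $ i $ j * \<phi> x)))"

definition sobolev_W1p :: "real \<Rightarrow> (real^'n) set \<Rightarrow> (real^'n \<Rightarrow> real^'m) \<Rightarrow> bool" where
  "sobolev_W1p p U u \<longleftrightarrow> Lp_on p U u \<and> (\<exists>G. weak_jacobian U u G \<and> Lp_on p U G)"

end

theory Submission
  imports Defs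
begin

text \<open>
  Write \<open>r = \<bar>x\<bar>\<close>, \<open>n = x / r\<close> and \<open>N = n \<otimes> n\<close>, so that \<open>Du = (I - N) / r\<close>, which has norm \<open>1 / r > 1\<close> and is
  orthogonal to \<open>N\<close>. The \<open>p\<close>-Laplacian flux of \<open>u\<close> is \<open>r powr (1 - p) * (I - N)\<close>; adding
  \<open>c * r powr (1 - p) * N\<close> with \<open>c = 1 / (2 - p)\<close> makes it divergence free away from the origin, and since
  \<open>p < 2\<close> the singularity carries no mass. The extra term is produced by \<open>c * q powr ((p - 1) / 2) * N\<close>, where \<open>q\<close> is
  the square of the gradient norm. To keep the system elliptic although \<open>c\<close> may be large, squared lengths in the
  direction \<open>N\<close>, which \<open>Du\<close> does not see, are multiplied by \<open>1 + k\<close>. The weak Jacobian is unique almost everywhere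
  by the fundamental lemma of the calculus of variations, hence every weak Jacobian yields the same flux.
\<close>

section \<open>Smooth bump functions and the fundamental lemma\<close>

text \<open>The value of \<open>c\<close> is forced. In the plane,
  \<open>r powr (1 - p) * (I - N)\<close> has row divergence \<open>- r powr (- 1 - p) * x\<close>,
  while \<open>r powr (1 - p) * N\<close> has \<open>(2 - p) * r powr (- 1 - p) * x\<close>; they
  cancel exactly for \<open>c = 1 / (2 - p)\<close>, which blows up as \<open>p\<close> tends to 2.
  The coefficients may not see \<open>x\<close>, but on the disc \<open>N\<close> is a function of
  \<open>u\<close> and \<open>r\<close> is the inverse of the norm of \<open>Du\<close>, so the
  correction can be written in terms of \<open>u\<close> and \<open>Du\<close> with the admissible
  growth \<open>p - 1\<close>.

  The obstacle is ellipticity. Differentiating the correction in \<open>z\<close> gives a cross term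
  proportional to \<open>c * (z \<bullet> l) * (N \<bullet> l)\<close>, of the same order as the
  ellipticity of the \<open>p\<close>-Laplacian and of no definite sign, so for large
  \<open>c\<close> it could win. Stretching along \<open>N\<close> makes the quadratic form in
  \<open>l\<close> control \<open>k * (N \<bullet> l)^2\<close>, and \<open>k = 4 * c^2\<close> is
  what absorbs the cross term.

  Since \<open>N\<close> is extended to a bounded Lipschitz function of \<open>u\<close>, condition
  (iv) holds for all exponents \<open>\<alpha>\<close> with one and the same
  \<open>L\<close>.\<close>

lemma Ck_on_imp_continuous_on: "Ck_on n S f \<Longrightarrow> continuous_on S f"
  by (cases n) (auto intro: differentiable_imp_continuous_on
      simp: differentiable_on_def differentiable_at_withinI)

text \<open>Uniqueness of the Frechet derivative lets any explicit derivative formula replace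
  \<open>frechet_derivative\<close> in the recursion; the concrete smoothness proofs pass through
  this rule.\<close>

lemma Ck_on_SucI:
  assumes "\<And>x. (f has_derivative f' x) (at x)" "\<And>v. Ck_on n UNIV (\<lambda>x. f' x v)"
  shows "Ck_on (Suc n) UNIV f"
proof -
  have "frechet_derivative f (at x) = f' x" for x
    using frechet_derivative_at[OF assms(1)] by simp
  then show ?thesis
    using assms by (auto simp: differentiable_def)
qed

lemma Ck_on_has_derivative:
  assumes "Ck_on (Suc n) UNIV f"
  shows "(f has_derivative frechet_derivative f (at x)) (at x)"
  using assms by (simp add: frechet_derivative_works)

lemma Ck_on_SucD: "Ck_on (Suc n) S f \<Longrightarrow> Ck_on n S f"
proof (induction n arbitrary: f)
  case 0
  then show ?case using Ck_on_imp_continuous_on by (metis Ck_on.simps(1))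
next
  case (Suc n)
  then show ?case by (metis Ck_on.simps(2))
qed

lemma Ck_on_const: "Ck_on n UNIV (\<lambda>x. c)"
proof (induction n arbitrary: c)
  case (Suc n)
  show ?case by (rule Ck_on_SucI[where f' = "\<lambda>x v. 0"]) (auto intro: Suc)
qed auto

lemma Ck_on_bounded_linear:
  assumes "bounded_linear f"
  shows "Ck_on n UNIV f"
proof (cases n)
  case 0
  then show ?thesis using assms by (simp add: linear_continuous_on)
next
  case (Suc m)
  then show ?thesis
    using Ck_on_SucI[of f "\<lambda>x. f" m] bounded_linear_imp_has_derivative[OF assms] Ck_on_const
    by blast
qed

lemma Ck_on_add:
  "Ck_on n UNIV f \<Longrightarrow> Ck_on n UNIV g \<Longrightarrow> Ck_on n UNIV (\<lambda>x. f x + g x)"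
proof (induction n arbitrary: f g)
  case 0
  then show ?case by (simp add: continuous_on_add)
next
  case (Suc n)
  show ?case
    by (rule Ck_on_SucI[OF has_derivative_add[OF Ck_on_has_derivative[OF Suc.prems(1)]
          Ck_on_has_derivative[OF Suc.prems(2)]]])
      (use Suc in auto)
qed

lemma Ck_on_mult:
  fixes f g :: "'a::real_normed_vector \<Rightarrow> real"
  shows "Ck_on n UNIV f \<Longrightarrow> Ck_on n UNIV g \<Longrightarrow> Ck_on n UNIV (\<lambda>x. f x * g x)"
proof (induction n arbitrary: f g)
  case 0
  then show ?case by (simp add: continuous_on_mult)
next
  case (Suc n)
  \<comment> \<open>The product rule keeps one factor undifferentiated, so the order of
    \<open>f\<close> and \<open>g\<close> has to be lowered to \<open>n\<close> before the induction
    hypothesis applies.\<close>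
  note fg = Ck_on_SucD[OF Suc.prems(1)] Ck_on_SucD[OF Suc.prems(2)]
  show ?case
  proof (rule Ck_on_SucI[OF has_derivative_mult[OF Ck_on_has_derivative[OF Suc.prems(1)]
          Ck_on_has_derivative[OF Suc.prems(2)]]])
    fix v
    show "Ck_on n UNIV (\<lambda>x. f x * frechet_derivative g (at x) v + frechet_derivative f (at x) v * g x)"
      using Suc fg by (intro Ck_on_add Suc.IH) auto
  qed
qed

lemma Ck_on_prod:
  fixes f :: "'i \<Rightarrow> 'a::real_normed_vector \<Rightarrow> real"
  assumes "\<And>i. i \<in> I \<Longrightarrow> Ck_on n UNIV (f i)"
  shows "Ck_on n UNIV (\<lambda>x. \<Prod>i\<in>I. f i x)"
  using assms by (induction I rule: infinite_finite_induct) (auto intro: Ck_on_const Ck_on_mult)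

lemma Ck_on_inner_self: "Ck_on n UNIV (\<lambda>x::'a::real_inner. x \<bullet> x)"
proof (cases n)
  case (Suc m)
  have "Ck_on (Suc m) UNIV (\<lambda>x::'a. x \<bullet> x)"
  proof (rule Ck_on_SucI)
    show "((\<lambda>x::'a. x \<bullet> x) has_derivative (\<lambda>v. x \<bullet> v + v \<bullet> x)) (at x)" for x
      by (auto intro!: derivative_eq_intros)
    show "Ck_on m UNIV (\<lambda>x::'a. x \<bullet> v + v \<bullet> x)" for v
      by (intro Ck_on_bounded_linear bounded_linear_add bounded_linear_inner_left bounded_linear_inner_right)
  qed
  then show ?thesis using Suc by simp
qed (auto intro: continuous_intros)

text \<open>The linear span of the functions \<^term>\<open>flat k\<close> is closed under differentiation, so
  smoothness of \<^term>\<open>flat k\<close> follows by induction on the order for all \<open>k\<close> simultaneously.\<close>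

definition flat :: "nat \<Rightarrow> real \<Rightarrow> real" where
  "flat k t = (if t > 0 then exp (- 1 / t) / t ^ k else 0)"

lemma flat_nonneg: "0 \<le> flat k t"
  by (simp add: flat_def)

lemma flat_nonpos_arg: "t \<le> 0 \<Longrightarrow> flat k t = 0"
  by (simp add: flat_def)

lemma mult_flat: "t * flat (Suc k) t = flat k t"
  by (simp add: flat_def)

text \<open>The \<open>k\<close>-th term of the exponential series at \<open>1 / t\<close> is at
  most \<open>exp (1 / t)\<close>. The explicit bound serves both the derivative at 0 and the
  uniform constants for the cutoffs.\<close>

lemma flat_le_fact: "flat k t \<le> fact k"
proof (cases "t > 0")
  case True
  have "(1 / t) ^ k / fact k \<le> exp (1 / t)"
  proof -
    have s: "summable (\<lambda>n. (1 / t) ^ n /\<^sub>R fact n)"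
      by (rule summable_exp_generic)
    have "(\<Sum>n\<in>{k}. (1 / t) ^ n /\<^sub>R fact n) \<le> (\<Sum>n. (1 / t) ^ n /\<^sub>R fact n)"
      by (rule sum_le_suminf[OF s]) (use True in auto)
    then show ?thesis by (simp add: exp_def divide_inverse mult.commute)
  qed
  moreover have "exp (1 / t) * exp (- 1 / t) = 1"
    by (simp flip: exp_add)
  ultimately have "(1 / t) ^ k / fact k * exp (- 1 / t) \<le> 1"
    by (metis exp_ge_zero mult_right_mono)
  then show ?thesis
    using True by (simp add: flat_def field_simps)
qed (simp add: flat_def)

lemma has_real_derivative_flat:
  "(flat k has_real_derivative (flat (Suc (Suc k)) t - real k * flat (Suc k) t)) (at t)"
proof -
  consider "t > 0" | "t < 0" | "t = 0" by linarith
  then show ?thesis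
  proof cases
    case 1
    have "((\<lambda>t. exp (- 1 / t) / t ^ k) has_real_derivative
        (flat (Suc (Suc k)) t - real k * flat (Suc k) t)) (at t)"
    proof -
      have "((\<lambda>t. exp (- inverse t) * inverse t ^ k) has_real_derivative
         exp (- inverse t) * inverse t ^ Suc (Suc k) - real k * (exp (- inverse t) * inverse t ^ Suc k)) (at t)"
      proof -
        have e: "((\<lambda>t. exp (- inverse t)) has_real_derivative exp (- inverse t) * (inverse t * inverse t)) (at t)"
          using 1 by (auto intro!: derivative_eq_intros)
        have i: "(inverse has_real_derivative - (inverse t * inverse t)) (at t)"
          using 1 by (auto intro!: derivative_eq_intros)
        have p: "((\<lambda>t. inverse t ^ k) has_real_derivative - (real k * inverse t ^ Suc k)) (at t)"
        proof (cases k)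
          case (Suc j)
          show ?thesis
            unfolding Suc by (rule DERIV_cong[OF DERIV_power_Suc[OF i]]) simp
        qed simp
        show ?thesis
          by (rule DERIV_cong[OF DERIV_mult[OF e p]]) (simp add: algebra_simps)
      qed
      then show ?thesis
        using 1 by (simp add: flat_def divide_inverse power_inverse)
    qed
    then show ?thesis
      by (rule has_field_derivative_transform_within_open[of _ _ _ "{0<..}"]) (use 1 in \<open>auto simp: flat_def\<close>)
  next
    case 2
    have "((\<lambda>t. 0) has_real_derivative (flat (Suc (Suc k)) t - real k * flat (Suc k) t)) (at t)"
      using 2 by (simp add: flat_def)
    then show ?thesis
      by (rule has_field_derivative_transform_within_open[of _ _ _ "{..<0}"]) (use 2 in \<open>auto simp: flat_def\<close>)
  next
    case 3
    have "((\<lambda>h. (flat k (0 + h) - flat k 0) / h) \<longlongrightarrow> 0) (at 0)"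
    proof (rule Lim_null_comparison)
      show "\<forall>\<^sub>F h in at 0. norm ((flat k (0 + h) - flat k 0) / h) \<le> fact (Suc (Suc k)) * \<bar>h\<bar>"
      proof (rule eventuallyI)
        fix h :: real
        \<comment> \<open>Two powers of \<open>1 / h\<close> are moved into the index:
          \<open>flat k h / h = flat (k + 1) h = h * flat (k + 2) h\<close>. As
          \<open>flat (k + 2)\<close> is bounded, the quotient tends to 0. For
          \<open>h \<le> 0\<close> both sides are 0.\<close>
        have "(flat k (0 + h) - flat k 0) / h = h * flat (Suc (Suc k)) h"
          by (simp add: flat_def field_simps)
        then show "norm ((flat k (0 + h) - flat k 0) / h) \<le> fact (Suc (Suc k)) * \<bar>h\<bar>"
          using mult_left_mono[OF flat_le_fact[of "Suc (Suc k)" h], of "\<bar>h\<bar>"] flat_nonneg[of "Suc (Suc k)" h]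
          by (simp add: abs_mult mult.commute)
      qed
      show "((\<lambda>h. fact (Suc (Suc k)) * \<bar>h\<bar>) \<longlongrightarrow> (0::real)) (at 0)"
        by (auto intro!: tendsto_eq_intros)
    qed
    then show ?thesis
      using 3 by (simp add: has_field_derivative_def field_has_derivative_at DERIV_def flat_def)
  qed
qed

lemma continuous_on_flat [continuous_intros]:
  "continuous_on S f \<Longrightarrow> continuous_on S (\<lambda>x. flat k (f x))"
  by (rule continuous_on_compose2[of UNIV "flat k"])
    (auto intro: DERIV_continuous_on has_field_derivative_at_within has_real_derivative_flat)

lemma borel_measurable_flat [measurable]: "flat k \<in> borel_measurable borel"
  by (intro borel_measurable_continuous_onI continuous_intros)

lemma Ck_on_flat:
  assumes "\<And>n. Ck_on n UNIV g"
  shows "Ck_on n UNIV (\<lambda>x. flat k (g x))"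
proof (induction n arbitrary: k)
  case 0
  then show ?case using assms[of 0] by (auto intro: continuous_intros)
next
  case (Suc n)
  show ?case
  proof (rule Ck_on_SucI)
    fix x
    show "((\<lambda>x. flat k (g x)) has_derivative
       (\<lambda>v. (flat (Suc (Suc k)) (g x) + (- real k) * flat (Suc k) (g x)) * frechet_derivative g (at x) v)) (at x)"
      using DERIV_compose_FDERIV[OF has_real_derivative_flat Ck_on_has_derivative[OF assms]]
      by (simp add: mult.commute)
  next
    fix v
    show "Ck_on n UNIV (\<lambda>x. (flat (Suc (Suc k)) (g x) + (- real k) * flat (Suc k) (g x)) * frechet_derivative g (at x) v)"
      using assms[of "Suc n"] by (intro Ck_on_mult Ck_on_add Suc Ck_on_const) auto
  qed
qed

section \<open>Indicators of open boxes as limits of smooth bumps\<close>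

lemma flat_0_le_1: "flat 0 t \<le> 1"
  using flat_le_fact[of 0 t] by simp

lemma filterlim_real_mult_minus_at_top:
  fixes c d :: real
  assumes "c > 0"
  shows "filterlim (\<lambda>n. real n * c - d) at_top sequentially"
  using filterlim_tendsto_add_at_top[OF tendsto_const
      filterlim_at_top_mult_tendsto_pos[OF tendsto_const assms filterlim_real_sequentially], of "- d"]
  by simp

lemma tendsto_flat_0_at_top: "(flat 0 \<longlongrightarrow> 1) at_top"
proof (rule Lim_transform_eventually)
  have "((\<lambda>t::real. exp (- inverse t)) \<longlongrightarrow> exp (- 0)) at_top"
    by (intro tendsto_exp tendsto_minus tendsto_inverse_0_at_top filterlim_ident)
  then show "((\<lambda>t::real. exp (- inverse t)) \<longlongrightarrow> 1) at_top" by simp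
  show "\<forall>\<^sub>F t in at_top. exp (- inverse t) = flat 0 t"
    using eventually_gt_at_top[of 0] by eventually_elim (simp add: flat_def divide_inverse)
qed

text \<open>If \<open>c > 0\<close> the argument tends to infinity, otherwise it stays nonpositive
  for all \<open>n\<close>. The shift \<open>d\<close> does not change the limit;
  \<open>d = 1\<close> will be used to keep supports away from the unit circle.\<close>

lemma flat_0_indicator_LIMSEQ:
  assumes "d \<ge> 0"
  shows "(\<lambda>n. flat 0 (real n * c - d)) \<longlonglongrightarrow> of_bool (c > 0)"
proof (cases "c > 0")
  case False
  then have "real n * c - d \<le> 0" for n
    using assms by (simp add: mult_nonneg_nonpos order_trans[of _ 0] )
  then show ?thesis using False by (simp add: flat_nonpos_arg)
qed (use filterlim_compose[OF tendsto_flat_0_at_top filterlim_real_mult_minus_at_top] in simp)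

lemma box_indicator_eq_prod:
  "indicator (box a b) x = (\<Prod>i\<in>Basis. of_bool (x \<bullet> i - a \<bullet> i > 0) * of_bool (b \<bullet> i - x \<bullet> i > 0) :: real)"
proof (cases "x \<in> box a b")
  case True
  then show ?thesis by (auto simp: box_def)
next
  case False
  then obtain i where "i \<in> Basis" "\<not> (x \<bullet> i - a \<bullet> i > 0 \<and> b \<bullet> i - x \<bullet> i > 0)"
    by (auto simp: box_def)
  then have "(\<Prod>i\<in>Basis. of_bool (x \<bullet> i - a \<bullet> i > 0) * of_bool (b \<bullet> i - x \<bullet> i > 0) :: real) = 0"
    by (intro prod_zero) auto
  then show ?thesis using False by simp
qed

text \<open>A Dynkin argument: boxes are stable under intersection and generate the Borel sets, and
  the sets over which \<open>f\<close> integrates to 0 are closed under complements and countable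
  disjoint unions. Then \<open>f\<close> and 0 have equal integrals over every Borel set.\<close>

lemma AE_eq_0_if_box_integrals_eq_0:
  fixes f :: "'a::euclidean_space \<Rightarrow> real"
  assumes f: "integrable lborel f"
    and box: "\<And>a b. (LINT x:box a b|lborel. f x) = 0"
  shows "AE x in lborel. f x = 0"
proof (rule density_unique_real[OF f])
  show "integrable lborel (\<lambda>x::'a. 0::real)" by simp
  fix A :: "'a set" assume "A \<in> sets lborel"
  have si: "set_integrable lborel A f" if "A \<in> sets borel" for A
    using integrable_mult_indicator[OF _ f, of A] that by (simp add: set_integrable_def)
  \<comment> \<open>The complement step needs the integral over the whole space, which is not a box
    and is therefore exhausted by growing boxes.\<close>
  have space: "(LINT x:UNIV|lborel. f x) = 0"
  proof -
    have "(\<lambda>n. LINT x:box (- real n *\<^sub>R One) (real n *\<^sub>R One)|lborel. f x)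
        \<longlonglongrightarrow> (LINT x:(\<Union>n::nat. box (- real n *\<^sub>R One) (real n *\<^sub>R One))|lborel. f x)"
    proof (rule set_integral_cont_up)
      show "incseq (\<lambda>n::nat. box (- real n *\<^sub>R One) (real n *\<^sub>R One :: 'a))"
        by (intro monoI subset_box_imp) auto
      show "set_integrable lborel (\<Union>n::nat. box (- real n *\<^sub>R One) (real n *\<^sub>R One)) f"
        by (rule si) auto
    qed auto
    then have "(LINT x:(\<Union>n::nat. box (- real n *\<^sub>R One) (real n *\<^sub>R One))|lborel. f x) = 0"
      by (simp add: box LIMSEQ_const_iff)
    then show ?thesis
      using UN_box_eq_UNIV[where 'a = 'a] by simp
  qed
  have stable: "Int_stable (range (\<lambda>(a, b). box a b :: 'a set))"
    by (auto simp: Int_stable_def box_Int_box)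
  have subset_Pow: "range (\<lambda>(a, b). box a b :: 'a set) \<subseteq> Pow UNIV"
    by simp
  have "A \<in> sigma_sets UNIV (range (\<lambda>(a, b). box a b))"
    using \<open>A \<in> sets lborel\<close> by (simp add: borel_eq_box)
  then have "(LINT x:A|lborel. f x) = 0"
  proof (induction rule: sigma_sets_induct_disjoint
      [OF stable subset_Pow, consumes 1, case_names basic empty compl union])
    case (basic A)
    then show ?case using box by auto
  next
    case empty
    then show ?case by (simp add: set_lebesgue_integral_def)
  next
    case (compl A)
    then have A: "A \<in> sets borel" by (simp add: borel_eq_box)
    have "(LINT x:UNIV|lborel. f x) = (LINT x:A \<union> (UNIV - A)|lborel. f x)" by simp
    also have "\<dots> = (LINT x:A|lborel. f x) + (LINT x:UNIV - A|lborel. f x)"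
      using A by (intro set_integral_Un si) auto
    finally show ?case using space compl by simp
  next
    case (union A)
    then have A: "A i \<in> sets borel" for i by (auto simp: borel_eq_box)
    have "(LINT x:\<Union>(range A)|lborel. f x) = (\<Sum>i. LINT x:A i|lborel. f x)"
      using union A by (intro lebesgue_integral_countable_add si) (auto simp: disjoint_family_on_def)
    then show ?case using union by simp
  qed
  then show "(LINT x:A|lborel. f x) = (LINT x:A|lborel. 0)"
    by simp
qed

lemma test_funI:
  fixes \<phi> :: "'a::euclidean_space \<Rightarrow> 'b::real_normed_vector"
  assumes "\<And>n. Ck_on n UNIV \<phi>" "compact K" "K \<subseteq> U" "\<And>x. x \<notin> K \<Longrightarrow> \<phi> x = 0"
  shows "test_fun U \<phi>"
proof -
  have "support_on UNIV \<phi> \<subseteq> K"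
    using assms(4) by (auto simp: support_on_def)
  then have "closure (support_on UNIV \<phi>) \<subseteq> K"
    by (intro closure_minimal compact_imp_closed assms)
  then show ?thesis
    using assms compact_Int_closed[OF assms(2), of "closure (support_on UNIV \<phi>)"]
    by (auto simp: test_fun_def smooth_on_def inf.absorb2)
qed

lemma Ck_on_flat_affine:
  fixes v :: "'a::euclidean_space"
  shows "Ck_on n UNIV (\<lambda>x. flat k (c * (x \<bullet> v + d)))"
  by (intro Ck_on_flat Ck_on_mult Ck_on_add Ck_on_const Ck_on_bounded_linear bounded_linear_inner_left)

text \<open>Compactness of the support comes from the last factor alone: it vanishes as soon as
  \<open>x \<bullet> x \<ge> 1 - 1 / n\<close>. The box factors only have to be smooth.\<close>

lemma test_fun_box_ball_bump:
  fixes a b :: "'a::euclidean_space"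
  assumes "n > 0"
  shows "test_fun (ball 0 1) (\<lambda>x.
    (\<Prod>i\<in>Basis. flat 0 (n * (x \<bullet> i - a \<bullet> i)) * flat 0 (n * (b \<bullet> i - x \<bullet> i)))
      * flat 0 (n * (1 - x \<bullet> x) - 1))"
proof (rule test_funI)
  fix m
  have 1: "Ck_on m UNIV (\<lambda>x. flat 0 (n * (x \<bullet> i - a \<bullet> i)))" for i
    using Ck_on_flat_affine[of m 0 n i "- (a \<bullet> i)"] by simp
  have 2: "Ck_on m UNIV (\<lambda>x. flat 0 (n * (b \<bullet> i - x \<bullet> i)))" for i
    using Ck_on_flat_affine[of m 0 n "- i" "b \<bullet> i"] by simp
  have 3: "Ck_on m UNIV (\<lambda>x::'a. flat 0 ((n - 1) + (- n) * (x \<bullet> x)))"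
    by (intro Ck_on_flat Ck_on_add Ck_on_mult Ck_on_const Ck_on_inner_self)
  show "Ck_on m UNIV (\<lambda>x.
    (\<Prod>i\<in>Basis. flat 0 (n * (x \<bullet> i - a \<bullet> i)) * flat 0 (n * (b \<bullet> i - x \<bullet> i)))
      * flat 0 (n * (1 - x \<bullet> x) - 1))"
    using 3 by (intro Ck_on_mult Ck_on_prod 1 2) (simp add: algebra_simps)
next
  \<comment> \<open>For \<open>n < 1\<close> the root of a negative number is negative, so this ball
    is empty and the bump is identically 0.\<close>
  show "compact (cball (0::'a) (sqrt (1 - 1 / n)))" by simp
  have "sqrt (1 - 1 / n) < 1" using assms by simp
  then show "cball (0::'a) (sqrt (1 - 1 / n)) \<subseteq> ball 0 1"
    by (auto simp del: real_sqrt_less_iff real_sqrt_lt_1_iff)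
next
  fix x :: 'a assume "x \<notin> cball 0 (sqrt (1 - 1 / n))"
  then have "sqrt (1 - 1 / n) < sqrt (x \<bullet> x)" by (simp add: norm_eq_sqrt_inner)
  then have "1 - 1 / n < x \<bullet> x" by simp
  then have "n * (1 - x \<bullet> x) - 1 \<le> 0" using assms by (simp add: field_simps)
  then show "(\<Prod>i\<in>Basis. flat 0 (n * (x \<bullet> i - a \<bullet> i)) * flat 0 (n * (b \<bullet> i - x \<bullet> i)))
      * flat 0 (n * (1 - x \<bullet> x) - 1) = 0"
    by (simp add: flat_nonpos_arg)
qed

text \<open>As \<open>n\<close> tends to infinity, the bumps converge to the indicator of \<open>box a b \<inter> ball 0 1\<close>, and boxes generate
  the Borel sets.\<close>

lemma fundamental_lemma_ball:
  fixes f :: "'a::euclidean_space \<Rightarrow> real"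
  assumes f: "set_integrable lborel (ball 0 1) f"
    and test: "\<And>\<phi>::'a \<Rightarrow> real. test_fun (ball 0 1) \<phi> \<Longrightarrow> (LINT x:ball 0 1|lborel. f x * \<phi> x) = 0"
  shows "AE x in lborel. x \<in> ball 0 1 \<longrightarrow> f x = 0"
proof -
  let ?F = "\<lambda>x. indicator (ball 0 1) x * f x"
  have F: "integrable lborel ?F"
    using f by (simp add: set_integrable_def)
  have [measurable]: "?F \<in> borel_measurable borel"
    using borel_measurable_integrable[OF F] by simp
  have "AE x in lborel. ?F x = 0"
  proof (rule AE_eq_0_if_box_integrals_eq_0[OF F])
    fix a b :: 'a
    define \<phi> where "\<phi> n x = (\<Prod>i\<in>Basis. flat 0 (n * (x \<bullet> i - a \<bullet> i)) * flat 0 (n * (b \<bullet> i - x \<bullet> i)))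
      * flat 0 (n * (1 - x \<bullet> x) - 1)" for n x
    have [measurable]: "\<phi> n \<in> borel_measurable borel" for n
      unfolding \<phi>_def by measurable
    have int0: "(\<integral>x. ?F x * \<phi> (Suc n) x \<partial>lborel) = 0" for n
      using test[OF test_fun_box_ball_bump[of "real (Suc n)" a b]]
      by (simp add: set_lebesgue_integral_def \<phi>_def mult.assoc)
    have lim: "(\<lambda>n. ?F x * \<phi> (Suc n) x) \<longlonglongrightarrow> indicator (box a b) x *\<^sub>R ?F x" for x
    proof -
      have "(\<lambda>n. \<phi> (real n) x) \<longlonglongrightarrow> (\<Prod>i\<in>Basis. of_bool (x \<bullet> i - a \<bullet> i > 0) * of_bool (b \<bullet> i - x \<bullet> i > 0))
          * of_bool (1 - x \<bullet> x > 0)"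
        unfolding \<phi>_def
        using flat_0_indicator_LIMSEQ[of 0] flat_0_indicator_LIMSEQ[of 1]
        by (intro tendsto_mult tendsto_prod) (simp_all del: zero_less_diff diff_gt_0_iff_gt of_bool_eq)
      then have "(\<lambda>n. ?F x * \<phi> (real (Suc n)) x) \<longlonglongrightarrow> ?F x * (indicator (box a b) x * of_bool (1 - x \<bullet> x > 0))"
        unfolding box_indicator_eq_prod by (intro tendsto_mult tendsto_const LIMSEQ_Suc)
      moreover have "x \<in> ball 0 1 \<longleftrightarrow> 1 - x \<bullet> x > 0"
        by (simp add: norm_eq_sqrt_inner)
      ultimately show ?thesis
        by (auto simp: indicator_def)
    qed
    have "(\<lambda>n. \<integral>x. ?F x * \<phi> (Suc n) x \<partial>lborel) \<longlonglongrightarrow> (\<integral>x. indicator (box a b) x *\<^sub>R ?F x \<partial>lborel)"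
    proof (rule integral_dominated_convergence[where w = "\<lambda>x. norm (?F x)"])
      show "integrable lborel (\<lambda>x. norm (?F x))" using F by simp
      have "\<bar>\<phi> (Suc n) x\<bar> \<le> 1" for n x
      proof -
        have "\<bar>\<phi> (Suc n) x\<bar> \<le> 1 * 1"
          unfolding \<phi>_def abs_mult
          by (intro mult_mono prod_le_1 flat_0_le_1 abs_ge_zero)
            (auto simp: abs_prod abs_mult flat_nonneg flat_0_le_1 intro!: prod_le_1 mult_le_one)
        then show ?thesis by simp
      qed
      then show "AE x in lborel. norm (?F x * \<phi> (Suc n) x) \<le> norm (?F x)" for n
        by (intro AE_I2) (simp add: abs_mult mult_left_le)
    qed (use lim in auto)
    then show "(LINT x:box a b|lborel. ?F x) = 0"
      using int0 by (simp add: set_lebesgue_integral_def LIMSEQ_const_iff)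
  qed
  then show ?thesis
    by eventually_elim (auto simp: indicator_def)
qed

section \<open>Integration by parts around a point singularity\<close>

text \<open>Dyadic shells: where \<open>(1/2)^(n+1) \<le> norm x < (1/2)^n\<close> the integrand is
  at most \<open>c n\<close>, and the shell lies in a ball of volume proportional to
  \<open>2^(- n * DIM('a))\<close>. The resulting series is geometric with ratio
  \<open>2 powr s / 2 ^ DIM('a) < 1\<close>. At the origin the integrand is 0, by the convention for
  \<open>powr\<close>.\<close>

lemma set_integrable_norm_powr_ball:
  fixes s :: real
  assumes "0 \<le> s" "s < DIM('a)"
  shows "set_integrable lborel (ball (0::'a::euclidean_space) 1) (\<lambda>x. norm x powr (- s))"
proof -
  let ?D = "DIM('a)"
  define c where "c n = 2 powr s * (2 powr s) ^ n" for n :: nat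
  have c_nonneg: "c n \<ge> 0" for n by (simp add: c_def)
  have shell: "ennreal (indicator (ball 0 1) x * norm x powr (- s))
      \<le> (\<Sum>n. ennreal (c n) * indicator (ball 0 ((1 / 2) ^ n)) x)" for x :: 'a
  proof (cases "x \<noteq> 0 \<and> norm x < 1")
    case True
    \<comment> \<open>The index of the shell that contains \<open>x\<close>; minimality yields the
      outer bound \<open>norm x < (1/2)^n\<close>.\<close>
    define n where "n = (LEAST n. (1 / 2) ^ Suc n \<le> norm x)"
    have "\<exists>n. (1 / 2) ^ Suc n \<le> norm x"
    proof -
      obtain m where "(1 / 2 :: real) ^ m < norm x"
        using real_arch_pow_inv[of "norm x" "1 / 2"] True by auto
      then have "(1 / 2 :: real) ^ Suc m \<le> norm x"
        using norm_ge_zero[of x] unfolding power_Suc by linarith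
      then show ?thesis by blast
    qed
    then have n: "(1 / 2) ^ Suc n \<le> norm x"
      unfolding n_def by (rule LeastI_ex)
    have n': "norm x < (1 / 2) ^ n"
    proof (cases n)
      case (Suc m)
      then have "\<not> (1 / 2) ^ Suc m \<le> norm x"
        using not_less_Least[of m "\<lambda>n. (1 / 2) ^ Suc n \<le> norm x"] by (simp add: n_def)
      then show ?thesis using Suc by simp
    qed (use True in simp)
    have "norm x powr (- s) \<le> ((1 / 2) ^ Suc n) powr (- s)"
      using n assms by (intro powr_mono2') auto
    also have "\<dots> = c n"
    proof -
      have "((1 / 2 :: real) ^ Suc n) powr (- s) = (2 ^ Suc n) powr s"
        by (simp add: powr_minus power_divide powr_divide)
      also have "\<dots> = (2 powr s) ^ Suc n"
        using powr_realpow[of "2 powr s" "Suc n"] powr_realpow[of 2 "Suc n"]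
        by (metis mult.commute powr_powr zero_less_numeral powr_gt_zero)
      finally show ?thesis by (simp add: c_def)
    qed
    finally have "ennreal (indicator (ball 0 1) x * norm x powr (- s)) \<le> ennreal (c n)"
      using True by (intro ennreal_leI) (simp add: indicator_def)
    also have "\<dots> = ennreal (c n) * indicator (ball 0 ((1 / 2) ^ n)) x"
      using n' by (simp add: indicator_def)
    also have "\<dots> \<le> (\<Sum>n. ennreal (c n) * indicator (ball 0 ((1 / 2) ^ n)) x)"
      using sum_le_suminf[of "\<lambda>n. ennreal (c n) * indicator (ball 0 ((1 / 2) ^ n)) x" "{n}"]
      by (simp del: indicator_simps sum_mult_indicator sum_mult_of_bool_eq mem_ball)
    finally show ?thesis .
  qed (auto simp: indicator_def)
  have [measurable]: "ball (0::'a) e \<in> sets borel" for e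
    by simp
  have meas: "(\<lambda>x. ennreal (c n) * indicator (ball (0::'a) ((1 / 2) ^ n)) x) \<in> borel_measurable lborel" for n
    by measurable
  define r where "r = 2 powr s / 2 ^ ?D"
  have "2 powr s < 2 powr real ?D"
    using assms by (intro powr_less_mono) auto
  then have r: "0 \<le> r" "r < 1"
    by (simp_all add: r_def powr_realpow)
  have "(\<integral>\<^sup>+x. ennreal (indicator (ball (0::'a) 1) x * norm x powr (- s)) \<partial>lborel)
      \<le> (\<integral>\<^sup>+x. (\<Sum>n. ennreal (c n) * indicator (ball (0::'a) ((1 / 2) ^ n)) x) \<partial>lborel)"
    by (intro nn_integral_mono shell)
  also have "\<dots> = (\<Sum>n. ennreal (c n) * emeasure lborel (ball (0::'a) ((1 / 2) ^ n)))"
    by (subst nn_integral_suminf[OF meas]) (intro suminf_cong nn_integral_cmult_indicator, simp)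
  also have "\<dots> = (\<Sum>n. ennreal (2 powr s * unit_ball_vol ?D * r ^ n))"
  proof (intro suminf_cong)
    fix n
    have "ennreal (c n) * emeasure lborel (ball (0::'a) ((1 / 2) ^ n))
        = ennreal (c n) * ennreal (unit_ball_vol ?D * ((1 / 2) ^ n) ^ ?D)"
      by (simp add: emeasure_ball)
    also have "\<dots> = ennreal (c n * (unit_ball_vol ?D * ((1 / 2) ^ n) ^ ?D))"
      by (rule ennreal_mult[symmetric]) (simp_all add: c_nonneg)
    also have "c n * (unit_ball_vol ?D * ((1 / 2) ^ n) ^ ?D) = 2 powr s * unit_ball_vol ?D * r ^ n"
      by (simp add: c_def r_def power_divide mult.commute flip: power_mult)
    finally show "ennreal (c n) * emeasure lborel (ball (0::'a) ((1 / 2) ^ n))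
        = ennreal (2 powr s * unit_ball_vol ?D * r ^ n)" .
  qed
  also have "\<dots> < \<infinity>"
  proof -
    have "summable (\<lambda>n. 2 powr s * unit_ball_vol ?D * r ^ n)"
      using r by (intro summable_mult summable_geometric) simp
    then have "(\<Sum>n. ennreal (2 powr s * unit_ball_vol ?D * r ^ n)) \<noteq> top"
      by (rule ennreal_suminf_neq_top) (use r in simp)
    then show ?thesis
      by (metis infinity_ennreal_def top.not_eq_extremum)
  qed
  finally have fin: "(\<integral>\<^sup>+x. ennreal (indicator (ball (0::'a) 1) x * norm x powr (- s)) \<partial>lborel) < \<infinity>" .
  have "(\<lambda>x::'a. indicator (ball 0 1) x * norm x powr (- s)) \<in> borel_measurable lborel"
    by measurable
  from integrableI_nonneg[OF this _ fin]
  have "integrable lborel (\<lambda>x::'a. indicator (ball 0 1) x * norm x powr (- s))"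
    by simp
  then show ?thesis
    by (simp add: set_integrable_def)
qed

section \<open>Integrals of directional derivatives, with and without a puncture\<close>

lemma has_derivative_imp_continuous_on:
  "(\<And>x. x \<in> S \<Longrightarrow> (f has_derivative f' x) (at x)) \<Longrightarrow> continuous_on S f"
  by (rule has_derivative_continuous_on[of S f f'], rule has_derivative_at_withinI)

lemma has_derivative_eq_0_if_locally_0:
  assumes "(f has_derivative f') (at x)" "open S" "x \<in> S" "\<And>y. y \<in> S \<Longrightarrow> f y = 0"
  shows "f' v = 0"
proof -
  have "(f has_derivative (\<lambda>v. 0)) (at x)"
    by (rule has_derivative_transform_within_open[OF has_derivative_const[of 0] assms(2,3)])
      (use assms(4) in auto)
  then show ?thesis using has_derivative_unique[OF assms(1)] by simp
qed

lemma integrable_continuous_support: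
  fixes f :: "'a::euclidean_space \<Rightarrow> real"
  assumes "continuous_on UNIV f" "compact K" "\<And>x. x \<notin> K \<Longrightarrow> f x = 0"
  shows "integrable lborel f"
proof -
  have "integrable lborel (\<lambda>x. indicator K x *\<^sub>R f x)"
    by (intro borel_integrable_compact continuous_on_subset[OF assms(1)] assms(2)) simp
  also have "(\<lambda>x. indicator K x *\<^sub>R f x) = f"
    using assms(3) by (fastforce simp: indicator_def)
  finally show ?thesis .
qed

lemma bounded_continuous_support:
  fixes f :: "'a::euclidean_space \<Rightarrow> real"
  assumes "continuous_on UNIV f" "compact K" "\<And>x. x \<notin> K \<Longrightarrow> f x = 0"
  obtains M where "M \<ge> 0" "\<And>x. \<bar>f x\<bar> \<le> M"
proof -
  have "bounded (f ` K)"
    using assms continuous_on_subset compact_continuous_image compact_imp_bounded by (metis subset_UNIV)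
  then obtain M where M: "M > 0" "\<And>x. x \<in> K \<Longrightarrow> \<bar>f x\<bar> \<le> M"
    by (auto simp: bounded_pos)
  then have "\<bar>f x\<bar> \<le> M" for x
    using assms(3)[of x] by (cases "x \<in> K") auto
  then show thesis using that[of M] M by simp
qed

lemma integral_lborel_translate:
  fixes f :: "'a::euclidean_space \<Rightarrow> real"
  assumes "integrable lborel f"
  shows "integrable lborel (\<lambda>x. f (c + x))" "(\<integral>x. f (c + x) \<partial>lborel) = (\<integral>x. f x \<partial>lborel)"
proof -
  have [measurable]: "f \<in> borel_measurable borel"
    using borel_measurable_integrable[OF assms] by simp
  have "integrable (distr lborel borel ((+) c)) f"
    using assms by (simp add: lborel_distr_plus)
  then show "integrable lborel (\<lambda>x. f (c + x))"
    by (subst (asm) integrable_distr_eq) auto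
  have "(\<integral>x. f x \<partial>distr lborel borel ((+) c)) = (\<integral>x. f (c + x) \<partial>lborel)"
    by (rule integral_distr) auto
  then show "(\<integral>x. f (c + x) \<partial>lborel) = (\<integral>x. f x \<partial>lborel)"
    by (simp add: lborel_distr_plus)
qed

text \<open>The difference quotients have integral zero by translation invariance and converge boundedly.\<close>

lemma integral_directional_derivative_eq_0:
  fixes f :: "'a::euclidean_space \<Rightarrow> real"
  assumes f: "\<And>x. (f has_derivative f' x) (at x)"
    and cont: "continuous_on UNIV (\<lambda>x. f' x v)"
    and supp: "\<And>x. norm x > R \<Longrightarrow> f x = 0"
  shows "(\<integral>x. f' x v \<partial>lborel) = 0"
proof -
  have "continuous_on UNIV f"
    using f by (intro has_derivative_imp_continuous_on) auto
  then have int: "integrable lborel f"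
    by (rule integrable_continuous_support[of _ "cball 0 R"]) (auto intro: supp)
  have g0: "f' x v = 0" if "norm x > R" for x
    by (rule has_derivative_eq_0_if_locally_0[OF f, where S = "- cball 0 R"]) (use that supp in auto)
  then obtain M where M: "\<And>x. \<bar>f' x v\<bar> \<le> M"
    using bounded_continuous_support[OF cont compact_cball[of 0 R]] g0 by (metis mem_cball_0 not_le)
  define q where "q n x = real (Suc n) * (f (inverse (real (Suc n)) *\<^sub>R v + x) - f x)" for n x
  have line: "((\<lambda>t. f (t *\<^sub>R v + x)) has_real_derivative f' (t *\<^sub>R v + x) v) (at t)" for t x
  proof -
    have "((\<lambda>t. f (t *\<^sub>R v + x)) has_derivative (\<lambda>h. f' (t *\<^sub>R v + x) (h *\<^sub>R v + 0))) (at t)"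
      by (rule has_derivative_compose[OF _ f]) (auto intro!: derivative_eq_intros)
    then show ?thesis
      unfolding has_field_derivative_def
      using linear_scale[OF has_derivative_linear[OF f]]
      by (simp add: mult.commute[of "f' (t *\<^sub>R v + x) v"] mult_commute_abs)
  qed
  have lim: "(\<lambda>n. q n x) \<longlonglongrightarrow> f' x v" for x
  proof -
    have "((\<lambda>h. (f ((0 + h) *\<^sub>R v + x) - f (0 *\<^sub>R v + x)) / h) \<longlongrightarrow> f' x v) (at 0)"
      using line[of x 0] by (simp add: DERIV_def)
    moreover have "filterlim (\<lambda>n. inverse (real (Suc n))) (at 0) sequentially"
      using LIMSEQ_inverse_real_of_nat by (simp add: filterlim_at)
    ultimately show ?thesis
      by (drule_tac filterlim_compose) (auto simp: q_def divide_inverse mult.commute)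
  qed
  \<comment> \<open>Inside the enlarged ball the mean value theorem turns the quotient into a value
    of the derivative. Outside it, a step of length at most \<open>norm v\<close> cannot reach the
    support, so both values of \<open>f\<close> vanish.\<close>
  have bound: "\<bar>q n x\<bar> \<le> M * indicator (cball 0 (R + norm v)) x" for n x
  proof (cases "x \<in> cball 0 (R + norm v)")
    case True
    have "\<exists>z>0. z < inverse (real (Suc n)) \<and> f (inverse (real (Suc n)) *\<^sub>R v + x) - f (0 *\<^sub>R v + x)
        = (inverse (real (Suc n)) - 0) * f' (z *\<^sub>R v + x) v"
      by (rule MVT2) (use line in auto)
    then obtain z where "f (inverse (real (Suc n)) *\<^sub>R v + x) - f x = inverse (real (Suc n)) * f' (z *\<^sub>R v + x) v"
      by auto
    then have "q n x = f' (z *\<^sub>R v + x) v"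
      by (simp add: q_def del: of_nat_Suc)
    then show ?thesis using True M by simp
  next
    case False
    then have "norm x > R + norm v" by simp
    moreover have "norm (inverse (real (Suc n)) *\<^sub>R v) \<le> norm v"
      by (simp add: mult_left_le_one_le inverse_le_1_iff)
    ultimately have "norm (inverse (real (Suc n)) *\<^sub>R v + x) > R" "norm x > R"
      using norm_triangle_ineq4[of "inverse (real (Suc n)) *\<^sub>R v + x" "inverse (real (Suc n)) *\<^sub>R v"]
        norm_ge_zero[of v] by (auto simp del: norm_ge_zero)
    then show ?thesis using supp False by (simp add: q_def)
  qed
  have [measurable]: "f \<in> borel_measurable borel" "(\<lambda>x. f' x v) \<in> borel_measurable borel"
    using \<open>continuous_on UNIV f\<close> cont by (auto intro: borel_measurable_continuous_onI)
  have "(\<lambda>n. \<integral>x. q n x \<partial>lborel) \<longlonglongrightarrow> (\<integral>x. f' x v \<partial>lborel)"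
  proof (rule integral_dominated_convergence[where w = "\<lambda>x. M * indicator (cball 0 (R + norm v)) x"])
    show "integrable lborel (\<lambda>x. M * indicator (cball 0 (R + norm v)) x)"
      using emeasure_bounded_finite[OF bounded_cball, of 0 "R + norm v"]
      by (intro integrable_mult_right integrable_real_indicator) auto
  qed (use lim bound in \<open>auto simp: q_def\<close>)
  moreover have "(\<integral>x. q n x \<partial>lborel) = 0" for n
    using integral_lborel_translate[OF int] int by (simp add: q_def)
  ultimately show ?thesis by (simp add: LIMSEQ_const_iff)
qed

lemma tendsto_flat_Suc_at_top: "(flat (Suc k) \<longlongrightarrow> 0) at_top"
proof (rule Lim_null_comparison)
  show "\<forall>\<^sub>F t in at_top. norm (flat (Suc k) t) \<le> fact k * inverse t"
    using eventually_gt_at_top[of 0]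
  proof eventually_elim
    case (elim t)
    then show ?case
      using flat_le_fact[of k t] flat_nonneg[of "Suc k" t] mult_flat[of t k] by (simp add: field_simps)
  qed
  show "((\<lambda>t. fact k * inverse t) \<longlongrightarrow> (0::real)) at_top"
    using tendsto_mult[OF tendsto_const tendsto_inverse_0_at_top[OF filterlim_ident]] by fastforce
qed

text \<open>The singularity is removed with the cutoffs \<open>flat 0 (n \<bar>x\<bar>\<^sup>2 - 1)\<close>, whose derivatives are bounded
  by a constant times \<open>1 / \<bar>x\<bar>\<close>, uniformly in \<open>n\<close>.\<close>

lemma integral_directional_derivative_eq_0_punctured:
  fixes f :: "'a::euclidean_space \<Rightarrow> real"
  assumes f: "\<And>x. x \<noteq> 0 \<Longrightarrow> (f has_derivative f' x) (at x)"
    and cont: "continuous_on (- {0}) (\<lambda>x. f' x v)"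
    and supp: "\<And>x. norm x > R \<Longrightarrow> f x = 0"
    and int': "integrable lborel (\<lambda>x. f' x v)"
    and int: "integrable lborel (\<lambda>x. f x / norm x)"
  shows "(\<integral>x. f' x v \<partial>lborel) = 0"
proof -
  define \<tau> where "\<tau> n x = real (Suc n) * (x \<bullet> x) - 1" for n and x :: 'a
  \<comment> \<open>By the derivative formula at \<open>k = 0\<close>, the derivative of
    \<open>flat 0\<close> is \<open>flat 2\<close>; so \<open>H' n\<close> is the product rule for
    cutoff times \<open>f\<close>. Both flat factors vanish near the origin, which makes the product
    differentiable across it.\<close>
  define H' where "H' n x w = flat 0 (\<tau> n x) * f' x w + flat 2 (\<tau> n x) * (2 * real (Suc n) * (x \<bullet> w)) * f x"
    for n x w
  have near0: "open {x. \<tau> n x < 0}" "0 \<in> {x. \<tau> n x < 0}" for n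
    unfolding \<tau>_def by (auto intro!: open_Collect_less continuous_intros)
  have H'0: "(\<integral>x. H' n x v \<partial>lborel) = 0" and contH': "continuous_on UNIV (\<lambda>x. H' n x v)" for n
  proof -
    show contH': "continuous_on UNIV (\<lambda>x. H' n x v)"
    proof -
      have "continuous_on (- {0}) f"
        using f by (intro has_derivative_imp_continuous_on) auto
      then have "continuous_on (- {0}) (\<lambda>x. H' n x v)"
        unfolding H'_def \<tau>_def by (intro continuous_intros cont)
      moreover have "continuous_on {x. \<tau> n x < 0} (\<lambda>x. H' n x v)"
        by (rule continuous_on_eq[of _ "\<lambda>x. 0"]) (auto simp: H'_def flat_nonpos_arg)
      ultimately have "continuous_on (- {0} \<union> {x. \<tau> n x < 0}) (\<lambda>x. H' n x v)"
        using near0 by (intro continuous_on_open_Un) auto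
      moreover have "- {0} \<union> {x. \<tau> n x < 0} = UNIV"
        using near0 by auto
      ultimately show ?thesis by simp
    qed
    show "(\<integral>x. H' n x v \<partial>lborel) = 0"
    proof (rule integral_directional_derivative_eq_0[where f' = "H' n" and R = R])
      show "((\<lambda>x. flat 0 (\<tau> n x) * f x) has_derivative H' n x) (at x)" for x
      proof (cases "x = 0")
        case True
        have "H' n 0 = (\<lambda>w. 0)"
          by (auto simp: H'_def flat_nonpos_arg \<tau>_def)
        then have "((\<lambda>x. 0) has_derivative H' n x) (at x)"
          using True by simp
        then show ?thesis
          by (rule has_derivative_transform_within_open[OF _ near0(1)[of n]])
            (use True near0 in \<open>auto simp: flat_nonpos_arg\<close>)
      next
        case False
        have "(\<tau> n has_derivative (\<lambda>w. 2 * real (Suc n) * (x \<bullet> w))) (at x)"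
          unfolding \<tau>_def by (auto intro!: derivative_eq_intros simp: inner_commute algebra_simps)
        from DERIV_compose_FDERIV[OF has_real_derivative_flat this, of 0]
        have "((\<lambda>x. flat 0 (\<tau> n x)) has_derivative (\<lambda>w. flat 2 (\<tau> n x) * (2 * real (Suc n) * (x \<bullet> w)))) (at x)"
          by (simp add: numeral_2_eq_2 mult.commute)
        from has_derivative_mult[OF this f[OF False]] show ?thesis
          by (simp add: H'_def[abs_def])
      qed
      show "norm x > R \<Longrightarrow> flat 0 (\<tau> n x) * f x = 0" for x
        by (simp add: supp)
      show "continuous_on UNIV (\<lambda>x. H' n x v)"
        by (rule contH')
    qed
  qed
  \<comment> \<open>The factor \<open>Suc n\<close> looks unbounded, but
    \<open>Suc n * (x \<bullet> x) = \<tau> n x + 1\<close> and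
    \<open>t * flat 2 t = flat 1 t\<close>, so it is traded for \<open>1 / (x \<bullet> x)\<close>
    times the bounded \<open>flat 1 + flat 2\<close>.\<close>
  have key: "flat 2 (\<tau> n x) * (2 * real (Suc n) * (x \<bullet> v)) * f x
      = (flat 1 (\<tau> n x) + flat 2 (\<tau> n x)) * (2 * (x \<bullet> v) * f x / (x \<bullet> x))" if "x \<noteq> 0" for n x
  proof -
    have "flat 1 (\<tau> n x) + flat 2 (\<tau> n x) = flat 2 (\<tau> n x) * (real (Suc n) * (x \<bullet> x))"
      using mult_flat[of "\<tau> n x" 1] by (simp add: \<tau>_def numeral_2_eq_2 algebra_simps)
    then show ?thesis using that by (simp add: field_simps)
  qed
  have lim: "(\<lambda>n. H' n x v) \<longlonglongrightarrow> f' x v" if "x \<noteq> 0" for x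
  proof -
    have "filterlim (\<lambda>n. real n * (x \<bullet> x) - 1) at_top sequentially"
      using that by (intro filterlim_real_mult_minus_at_top) simp
    then have \<tau>: "filterlim (\<lambda>n. \<tau> n x) at_top sequentially"
      unfolding \<tau>_def by (rule filterlim_compose[OF _ filterlim_Suc])
    have "(\<lambda>n. flat 0 (\<tau> n x) * f' x v + (flat (Suc 0) (\<tau> n x) + flat (Suc 1) (\<tau> n x)) * (2 * (x \<bullet> v) * f x / (x \<bullet> x)))
       \<longlonglongrightarrow> 1 * f' x v + (0 + 0) * (2 * (x \<bullet> v) * f x / (x \<bullet> x))"
      by (intro tendsto_intros filterlim_compose[OF tendsto_flat_0_at_top \<tau>]
          filterlim_compose[OF tendsto_flat_Suc_at_top \<tau>])
    then show ?thesis
      unfolding H'_def key[OF that] by (simp add: numeral_2_eq_2)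
  qed
  have bound: "\<bar>H' n x v\<bar> \<le> \<bar>f' x v\<bar> + 6 * norm v * \<bar>f x / norm x\<bar>" if "x \<noteq> 0" for n x
  proof -
    have "\<bar>flat 0 (\<tau> n x) * f' x v\<bar> \<le> \<bar>f' x v\<bar>"
      using flat_nonneg[of 0] flat_0_le_1 by (simp add: abs_mult mult_left_le_one_le)
    moreover have "\<bar>flat 2 (\<tau> n x) * (2 * real (Suc n) * (x \<bullet> v)) * f x\<bar> \<le> 3 * (2 * norm v * \<bar>f x / norm x\<bar>)"
    proof -
      have "\<bar>x \<bullet> v\<bar> / (x \<bullet> x) \<le> norm x * norm v / (x \<bullet> x)"
        by (intro divide_right_mono Cauchy_Schwarz_ineq2) simp
      also have "\<dots> = norm v / norm x"
        using that by (simp add: power2_norm_eq_inner[symmetric] power2_eq_square)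
      finally have "2 * (\<bar>x \<bullet> v\<bar> / (x \<bullet> x)) * \<bar>f x\<bar> \<le> 2 * (norm v / norm x) * \<bar>f x\<bar>"
        by (intro mult_right_mono mult_left_mono) auto
      then have "\<bar>2 * (x \<bullet> v) * f x / (x \<bullet> x)\<bar> \<le> 2 * norm v * \<bar>f x / norm x\<bar>"
        by (simp add: abs_mult)
      \<comment> \<open>The 3 is \<open>fact 1 + fact 2\<close>; with the 2 from the gradient of
        \<open>x \<bullet> x\<close> it gives the 6 in the dominating function.\<close>
      moreover have "\<bar>flat 1 (\<tau> n x) + flat 2 (\<tau> n x)\<bar> \<le> 3"
        using flat_le_fact[of 1 "\<tau> n x"] flat_le_fact[of 2 "\<tau> n x"] flat_nonneg[of 1 "\<tau> n x"] flat_nonneg[of 2 "\<tau> n x"]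
        by (simp add: fact_numeral)
      ultimately show ?thesis
        unfolding key[OF that] abs_mult[of "flat 1 _ + _"] by (intro mult_mono) auto
    qed
    ultimately show ?thesis
      unfolding H'_def by linarith
  qed
  have ae: "AE x::'a in lborel. x \<noteq> 0"
    by (rule AE_lborel_singleton)
  have "(\<lambda>n. \<integral>x. H' n x v \<partial>lborel) \<longlonglongrightarrow> (\<integral>x. f' x v \<partial>lborel)"
  proof (rule integral_dominated_convergence[where w = "\<lambda>x. \<bar>f' x v\<bar> + 6 * norm v * \<bar>f x / norm x\<bar>"])
    show "(\<lambda>x. f' x v) \<in> borel_measurable lborel"
      using int' by (rule borel_measurable_integrable)
    show "(\<lambda>x. H' n x v) \<in> borel_measurable lborel" for n
      using borel_measurable_continuous_onI[OF contH'] by simp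
    show "integrable lborel (\<lambda>x. \<bar>f' x v\<bar> + 6 * norm v * \<bar>f x / norm x\<bar>)"
      by (intro Bochner_Integration.integrable_add integrable_mult_right integrable_abs int int')
    show "AE x in lborel. (\<lambda>n. H' n x v) \<longlonglongrightarrow> f' x v"
      using ae by eventually_elim (rule lim)
    show "AE x in lborel. norm (H' n x v) \<le> \<bar>f' x v\<bar> + 6 * norm v * \<bar>f x / norm x\<bar>" for n
      using ae by eventually_elim (use bound in simp)
  qed
  then show ?thesis by (simp add: H'0 LIMSEQ_const_iff)
qed

text \<open>The punctured lemma is applied to the product \<open>g * \<phi>\<close>. All three
  functions whose integrability matters, \<open>g * \<phi>'\<close>, \<open>g' * \<phi>\<close> and
  \<open>g * \<phi> / norm x\<close>, are dominated by a multiple of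
  \<open>norm x powr (- q)\<close> on the ball, which is integrable because \<open>q\<close> is
  below the dimension.\<close>

lemma integration_by_parts_ball_punctured:
  fixes g \<phi> :: "'a::euclidean_space \<Rightarrow> real" and q :: real
  assumes q: "0 \<le> q" "q < DIM('a)"
    and g: "\<And>x. x \<noteq> 0 \<Longrightarrow> (g has_derivative g' x) (at x)"
    and g'_cont: "continuous_on (- {0}) (\<lambda>x. g' x v)"
    and g_bound: "\<And>x. x \<noteq> 0 \<Longrightarrow> \<bar>g x\<bar> \<le> C * norm x powr (1 - q)"
    and g'_bound: "\<And>x. x \<noteq> 0 \<Longrightarrow> \<bar>g' x v\<bar> \<le> C * norm x powr (- q)"
    and \<phi>: "\<And>x. (\<phi> has_derivative \<phi>' x) (at x)"
    and \<phi>'_cont: "continuous_on UNIV (\<lambda>x. \<phi>' x v)"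
    and K: "compact K" "K \<subseteq> ball 0 1" "\<And>x. x \<notin> K \<Longrightarrow> \<phi> x = 0"
  shows "set_integrable lborel (ball 0 1) (\<lambda>x. g x * \<phi>' x v)"
    and "set_integrable lborel (ball 0 1) (\<lambda>x. g' x v * \<phi> x)"
    and "(LINT x:ball 0 1|lborel. g x * \<phi>' x v) = - (LINT x:ball 0 1|lborel. g' x v * \<phi> x)"
proof -
  have \<phi>_cont: "continuous_on UNIV \<phi>"
    using \<phi> by (intro has_derivative_imp_continuous_on) auto
  have \<phi>'0: "\<phi>' x v = 0" if "x \<notin> K" for x
    by (rule has_derivative_eq_0_if_locally_0[OF \<phi>, where S = "- K"])
      (use that K compact_imp_closed in auto)
  obtain M1 where "M1 \<ge> 0" and M1: "\<And>x. \<bar>\<phi> x\<bar> \<le> M1"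
    by (rule bounded_continuous_support[OF \<phi>_cont K(1) K(3)]) (assumption | rule that)+
  obtain M2 where "M2 \<ge> 0" and M2: "\<And>x. \<bar>\<phi>' x v\<bar> \<le> M2"
    by (rule bounded_continuous_support[OF \<phi>'_cont K(1) \<phi>'0]) (assumption | rule that)+
  have g_cont: "continuous_on (- {0}) g"
    using g by (intro has_derivative_imp_continuous_on) auto
  have [measurable]: "g \<in> borel_measurable borel" "(\<lambda>x. g' x v) \<in> borel_measurable borel"
    using g_cont g'_cont by (auto intro: borel_measurable_continuous_countable_exceptions[of "{0}"])
  have [measurable]: "\<phi> \<in> borel_measurable borel" "(\<lambda>x. \<phi>' x v) \<in> borel_measurable borel"
    using \<phi>_cont \<phi>'_cont by (auto intro: borel_measurable_continuous_onI)
  let ?w = "\<lambda>M x. C * M * (indicator (ball 0 1) x * norm (x::'a) powr (- q))"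
  have w_int: "integrable lborel (?w M)" for M
    using set_integrable_norm_powr_ball[OF q] by (simp add: set_integrable_def)
  have ae: "AE x::'a in lborel. x \<noteq> 0"
    by (rule AE_lborel_singleton)
  \<comment> \<open>Evaluating the bound for \<open>g\<close> at a basis vector, which has norm 1,
    leaves \<open>C\<close> on the right.\<close>
  have C: "C \<ge> 0"
  proof -
    obtain i :: 'a where "i \<in> Basis" using nonempty_Basis by blast
    then show ?thesis using g_bound[of i] abs_ge_zero[of "g i"]
      by (simp add: nonzero_Basis del: abs_ge_zero)
  qed
  have b1: "\<bar>g x * \<phi>' x v\<bar> \<le> ?w M2 x" if "x \<noteq> 0" for x
  proof (cases "x \<in> K")
    case True
    then have "norm x < 1" using K by auto
    then have "norm x powr (1 - q) \<le> norm x powr (- q)"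
      by (intro powr_mono') auto
    then have "\<bar>g x\<bar> \<le> C * norm x powr (- q)"
      using g_bound[OF that] C mult_left_mono by fastforce
    then have "\<bar>g x\<bar> * \<bar>\<phi>' x v\<bar> \<le> C * norm x powr (- q) * M2"
      using C by (intro mult_mono M2) auto
    then show ?thesis using \<open>norm x < 1\<close> by (simp add: abs_mult indicator_def mult_ac)
  next
    case False
    then show ?thesis using \<open>M2 \<ge> 0\<close> C by (simp add: \<phi>'0)
  qed
  have b2: "\<bar>g' x v * \<phi> x\<bar> \<le> ?w M1 x" if "x \<noteq> 0" for x
  proof (cases "x \<in> K")
    case True
    then have "norm x < 1" using K by auto
    have "\<bar>g' x v\<bar> * \<bar>\<phi> x\<bar> \<le> C * norm x powr (- q) * M1"
      using C by (intro mult_mono M1 g'_bound that) auto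
    then show ?thesis using \<open>norm x < 1\<close> by (simp add: abs_mult indicator_def mult_ac)
  next
    case False
    then show ?thesis using \<open>M1 \<ge> 0\<close> C K by simp
  qed
  have b3: "\<bar>g x * \<phi> x / norm x\<bar> \<le> ?w M1 x" if "x \<noteq> 0" for x
  proof (cases "x \<in> K")
    case True
    then have "norm x < 1" using K by auto
    have "norm x powr (1 - q) / norm x = norm x powr (- q)"
      using that powr_diff[of "norm x" "1 - q" 1] by simp
    then have "\<bar>g x\<bar> / norm x \<le> C * norm x powr (- q)"
      using divide_right_mono[OF g_bound[OF that], of "norm x"] by (simp flip: times_divide_eq_right)
    then have "(\<bar>g x\<bar> / norm x) * \<bar>\<phi> x\<bar> \<le> C * norm x powr (- q) * M1"
      using C by (intro mult_mono M1) auto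
    then show ?thesis using \<open>norm x < 1\<close> by (simp add: abs_mult indicator_def mult_ac)
  next
    case False
    then show ?thesis using \<open>M1 \<ge> 0\<close> C K by simp
  qed
  have i1: "integrable lborel (\<lambda>x. g x * \<phi>' x v)"
    by (rule Bochner_Integration.integrable_bound[OF w_int[of M2]]) (use ae in \<open>auto elim!: eventually_mono intro: order_trans[OF b1 abs_ge_self]\<close>)
  have i2: "integrable lborel (\<lambda>x. g' x v * \<phi> x)"
    by (rule Bochner_Integration.integrable_bound[OF w_int[of M1]]) (use ae in \<open>auto elim!: eventually_mono intro: order_trans[OF b2 abs_ge_self]\<close>)
  have i3: "integrable lborel (\<lambda>x. g x * \<phi> x / norm x)"
    by (rule Bochner_Integration.integrable_bound[OF w_int[of M1]]) (use ae in \<open>auto elim!: eventually_mono intro: order_trans[OF b3[unfolded abs_divide abs_norm_cancel] abs_ge_self]\<close>)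
  have "(\<integral>x. g x * \<phi>' x v + g' x v * \<phi> x \<partial>lborel) = 0"
  proof (rule integral_directional_derivative_eq_0_punctured
      [where f = "\<lambda>x. g x * \<phi> x" and f' = "\<lambda>x w. g x * \<phi>' x w + g' x w * \<phi> x" and R = 1])
    show "continuous_on (- {0}) (\<lambda>x. g x * \<phi>' x v + g' x v * \<phi> x)"
      using \<phi>_cont \<phi>'_cont by (intro continuous_intros g_cont g'_cont) (auto intro: continuous_on_subset)
    show "1 < norm x \<Longrightarrow> g x * \<phi> x = 0" for x
      using K by fastforce
  qed (use g \<phi> i1 i2 i3 in \<open>auto intro: has_derivative_mult\<close>)
  then have *: "(\<integral>x. g x * \<phi>' x v \<partial>lborel) = - (\<integral>x. g' x v * \<phi> x \<partial>lborel)"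
    using i1 i2 by simp
  have ind: "(\<lambda>x. indicator (ball 0 1) x *\<^sub>R (g x * \<phi>' x v)) = (\<lambda>x. g x * \<phi>' x v)"
    "(\<lambda>x. indicator (ball 0 1) x *\<^sub>R (g' x v * \<phi> x)) = (\<lambda>x. g' x v * \<phi> x)"
    using K \<phi>'0 by (fastforce simp: indicator_def)+
  show "set_integrable lborel (ball 0 1) (\<lambda>x. g x * \<phi>' x v)"
    "set_integrable lborel (ball 0 1) (\<lambda>x. g' x v * \<phi> x)"
    "(LINT x:ball 0 1|lborel. g x * \<phi>' x v) = - (LINT x:ball 0 1|lborel. g' x v * \<phi> x)"
    unfolding set_integrable_def set_lebesgue_integral_def ind by (fact i1 i2 *)+
qed

section \<open>A strongly monotone vector field with a rank-one term\<close>

text \<open>A \<open>C\<^sup>1\<close> extension of \<open>q powr e\<close> from \<open>q \<ge> 1\<close>. For the radial map the argument is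
  \<open>1 / \<bar>x\<bar>\<^sup>2 > 1\<close>, so the linear part is never seen by the equation.\<close>

definition powr_ext :: "real \<Rightarrow> real \<Rightarrow> real" where
  "powr_ext e q = (if q \<le> 1 then 1 + e * (q - 1) else q powr e)"

lemma powr_ext_eq_powr: "q \<ge> 1 \<Longrightarrow> powr_ext e q = q powr e"
  by (auto simp: powr_ext_def)

text \<open>The linear piece is the tangent to \<open>q powr e\<close> at 1, so values and slopes
  agree there; \<open>max 1 q powr (e - 1)\<close> merges the two slope formulas.\<close>

lemma has_real_derivative_powr_ext:
  "(powr_ext e has_real_derivative e * max 1 q powr (e - 1)) (at q)"
proof -
  let ?f = "\<lambda>q. if q \<in> {..1} then 1 + e * (q - 1) else q powr e"
  have "(?f has_vector_derivative (if q \<in> {..1} then e else e * q powr (e - 1))) (at q within {..1} \<union> {1..})"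
  proof (rule has_vector_derivative_If_within_closures)
    show "((\<lambda>q. 1 + e * (q - 1)) has_vector_derivative e) (at q within {..1} \<union> closure {..1} \<inter> closure {1..})"
      by (auto intro!: derivative_eq_intros simp flip: has_real_derivative_iff_has_vector_derivative)
    show "((\<lambda>q. q powr e) has_vector_derivative e * q powr (e - 1)) (at q within {1..} \<union> closure {..1} \<inter> closure {1..})"
      if "q \<in> {1..} \<union> closure {..1} \<inter> closure {1..}"
      using that
      by (auto intro!: derivative_eq_intros simp flip: has_real_derivative_iff_has_vector_derivative)
  qed auto
  moreover have "{..1} \<union> {1::real..} = UNIV" by auto
  moreover have "?f = powr_ext e" by (auto simp: powr_ext_def)
  moreover have "(if q \<in> {..1} then e else e * q powr (e - 1)) = e * max 1 q powr (e - 1)"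
    by auto
  ultimately show ?thesis
    by (simp add: has_real_derivative_iff_has_vector_derivative)
qed

text \<open>On \<open>[0, 1]\<close> the tangent decreases from \<open>1 - e\<close> to 1, while the
  comparison power equals 1; beyond 1 there is equality with the power.\<close>

lemma powr_ext_bounds_neg:
  assumes "e \<le> 0" "q \<ge> 0"
  shows "max 1 q powr e \<le> powr_ext e q" "powr_ext e q \<le> (1 - e) * max 1 q powr e"
proof -
  have "e * q \<le> 0" using assms by (simp add: mult_nonpos_nonneg)
  moreover have "e * (q - 1) \<ge> 0" if "q \<le> 1" using assms that by (simp add: mult_nonpos_nonpos)
  ultimately show "max 1 q powr e \<le> powr_ext e q" "powr_ext e q \<le> (1 - e) * max 1 q powr e"
    using assms by (auto simp: powr_ext_def max_def algebra_simps mult_nonpos_nonneg)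
qed

lemma powr_ext_bounds_pos:
  assumes "0 \<le> e" "e \<le> 1" "q \<ge> 0"
  shows "0 \<le> powr_ext e q" "powr_ext e q \<le> max 1 q powr e"
proof -
  have "e * (1 - q) \<le> 1" if "q \<le> 1" using assms that by (intro mult_le_one) auto
  moreover have "e * (1 - q) \<ge> 0" if "q \<le> 1" using assms that by simp
  ultimately show "0 \<le> powr_ext e q" "powr_ext e q \<le> max 1 q powr e"
    using assms by (auto simp: powr_ext_def max_def algebra_simps)
qed

text \<open>Mean value inequality on \<open>{r..}\<close>, where \<open>e \<le> 1\<close> makes the
  slope largest at \<open>r\<close>. Later \<open>r\<close> is \<open>(norm z)^2\<close>, a common
  lower bound for the stretched squares belonging to two different \<open>N\<close>.\<close>

lemma powr_ext_diff_le:
  assumes "e \<le> 1" "r \<le> q" "r \<le> q'"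
  shows "\<bar>powr_ext e q - powr_ext e q'\<bar> \<le> \<bar>e\<bar> * max 1 r powr (e - 1) * \<bar>q - q'\<bar>"
proof -
  have "norm (powr_ext e q - powr_ext e q') \<le> \<bar>e\<bar> * max 1 r powr (e - 1) * norm (q - q')"
  proof (rule field_differentiable_bound[where S = "{r..}"])
    show "(powr_ext e has_field_derivative e * max 1 z powr (e - 1)) (at z within {r..})" for z
      by (rule has_field_derivative_at_within[OF has_real_derivative_powr_ext])
    show "norm (e * max 1 z powr (e - 1)) \<le> \<bar>e\<bar> * max 1 r powr (e - 1)" if "z \<in> {r..}" for z
      using that assms by (auto simp: abs_mult intro!: mult_left_mono powr_mono2')
  qed (use assms in auto)
  then show ?thesis by simp
qed

section \<open>The vector field, its derivative and its ellipticity\<close>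

text \<open>The symmetric linear map \<open>I + k * (N \<otimes> N)\<close>;
  \<open>stretch_sq\<close> below is its quadratic form, so the gradient of
  \<open>stretch_sq\<close> is twice \<open>stretch\<close>.\<close>

definition stretch :: "real \<Rightarrow> 'a::real_inner \<Rightarrow> 'a \<Rightarrow> 'a" where
  "stretch k N z = z + (k * (N \<bullet> z)) *\<^sub>R N"

definition stretch_sq :: "real \<Rightarrow> 'a::real_inner \<Rightarrow> 'a \<Rightarrow> real" where
  "stretch_sq k N z = z \<bullet> z + k * (N \<bullet> z)\<^sup>2"

text \<open>The first term is the \<open>p\<close>-Laplacian for the stretched inner product and is
  a gradient in \<open>z\<close>. The second, always a multiple of \<open>N\<close>, is the
  correction that restores zero divergence; its derivative in \<open>z\<close> has rank at most
  one.\<close>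

definition vfield :: "real \<Rightarrow> real \<Rightarrow> real \<Rightarrow> 'a::real_inner \<Rightarrow> 'a \<Rightarrow> 'a" where
  "vfield p c k N z = powr_ext ((p - 2) / 2) (stretch_sq k N z) *\<^sub>R stretch k N z
     + (c * powr_ext ((p - 1) / 2) (stretch_sq k N z)) *\<^sub>R N"

text \<open>The factors 1/2 in the exponents cancel against the gradient
  \<open>2 * stretch k N z\<close> of \<open>stretch_sq\<close>. It is assembled from bounded linear
  operators so that continuity in operator norm follows compositionally.\<close>

definition vfield_deriv :: "real \<Rightarrow> real \<Rightarrow> real \<Rightarrow> 'a::real_inner \<Rightarrow> 'a \<Rightarrow> 'a \<Rightarrow>\<^sub>L 'a" where
  "vfield_deriv p c k N z =
     powr_ext ((p - 2) / 2) (stretch_sq k N z) *\<^sub>R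
       (id_blinfun + (blinfun_scaleR_left N o\<^sub>L (k *\<^sub>R blinfun_inner_left N)))
     + (blinfun_scaleR_left
         (((p - 2) * max 1 (stretch_sq k N z) powr ((p - 2) / 2 - 1)) *\<^sub>R stretch k N z
          + (c * (p - 1) * max 1 (stretch_sq k N z) powr ((p - 1) / 2 - 1)) *\<^sub>R N)
       o\<^sub>L blinfun_inner_left (stretch k N z))"

lemma vfield_deriv_apply:
  "blinfun_apply (vfield_deriv p c k N z) l =
     powr_ext ((p - 2) / 2) (stretch_sq k N z) *\<^sub>R stretch k N l
     + (((p - 2) * max 1 (stretch_sq k N z) powr ((p - 2) / 2 - 1)) * (stretch k N z \<bullet> l)) *\<^sub>R stretch k N z
     + ((c * (p - 1) * max 1 (stretch_sq k N z) powr ((p - 1) / 2 - 1)) * (stretch k N z \<bullet> l)) *\<^sub>R N"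
  by (simp add: vfield_deriv_def blinfun.bilinear_simps stretch_def[of k N l] inner_commute algebra_simps)

lemma vfield_has_derivative:
  "(vfield p c k N has_derivative blinfun_apply (vfield_deriv p c k N z)) (at z)"
proof -
  have q: "(stretch_sq k N has_derivative (\<lambda>l. 2 * (stretch k N z \<bullet> l))) (at z)"
    unfolding stretch_sq_def
    by (auto intro!: derivative_eq_intros simp: stretch_def power2_eq_square inner_commute algebra_simps)
  have s: "(stretch k N has_derivative stretch k N) (at z)"
    unfolding stretch_def by (auto intro!: derivative_eq_intros)
  note d = DERIV_compose_FDERIV[OF has_real_derivative_powr_ext q]
  show ?thesis
    unfolding vfield_def
    by (rule derivative_eq_intros d s refl)+
      (simp add: fun_eq_iff vfield_deriv_apply algebra_simps diff_divide_distrib)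
qed

lemma continuous_on_powr_ext [continuous_intros]:
  "continuous_on S f \<Longrightarrow> continuous_on S (\<lambda>x. powr_ext e (f x))"
  by (rule continuous_on_compose2[of UNIV "powr_ext e"])
    (auto intro: DERIV_continuous_on has_field_derivative_at_within has_real_derivative_powr_ext)

lemma continuous_on_stretch [continuous_intros]:
  "continuous_on S f \<Longrightarrow> continuous_on S g \<Longrightarrow> continuous_on S (\<lambda>x. stretch k (f x) (g x))"
  unfolding stretch_def by (intro continuous_intros)

lemma continuous_on_stretch_sq [continuous_intros]:
  "continuous_on S f \<Longrightarrow> continuous_on S g \<Longrightarrow> continuous_on S (\<lambda>x. stretch_sq k (f x) (g x))"
  unfolding stretch_sq_def by (intro continuous_intros)

lemma continuous_on_vfield [continuous_intros]:
  "continuous_on S f \<Longrightarrow> continuous_on S g \<Longrightarrow> continuous_on S (\<lambda>x. vfield p c k (f x) (g x))"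
  unfolding vfield_def by (intro continuous_intros)

lemma continuous_on_vfield_deriv: "continuous_on UNIV (vfield_deriv p c k N)"
proof -
  have "continuous_on UNIV (\<lambda>z. max 1 (stretch_sq k N z) powr e)" for e
    by (intro continuous_intros) (auto simp: max_def)
  then show ?thesis
    unfolding vfield_deriv_def[abs_def] by (intro continuous_intros)
      (auto simp: max_def split: if_splits)
qed

lemma inner_stretch: "stretch k N l \<bullet> l = stretch_sq k N l"
  by (simp add: stretch_def stretch_sq_def inner_add_left power2_eq_square)

lemma stretch_sq_ge: "k \<ge> 0 \<Longrightarrow> (norm z)\<^sup>2 \<le> stretch_sq k N z"
  by (simp add: stretch_sq_def power2_norm_eq_inner)

lemma stretch_sq_nonneg: "k \<ge> 0 \<Longrightarrow> 0 \<le> stretch_sq k N z"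
  by (simp add: stretch_sq_def)

lemma inner_abs_le_norm_right: "norm N \<le> 1 \<Longrightarrow> \<bar>N \<bullet> z\<bar> \<le> norm z"
  using Cauchy_Schwarz_ineq2[of N z] mult_right_mono[of "norm N" 1 "norm z"] by simp

lemma stretch_sq_le:
  assumes "k \<ge> 0" "norm N \<le> 1"
  shows "stretch_sq k N z \<le> (1 + k) * (norm z)\<^sup>2"
proof -
  have "(N \<bullet> z)\<^sup>2 \<le> (norm z)\<^sup>2"
    using inner_abs_le_norm_right[OF assms(2)] abs_le_square_iff by fastforce
  then show ?thesis
    using assms by (simp add: stretch_sq_def power2_norm_eq_inner algebra_simps mult_left_mono)
qed

lemma norm_stretch_le:
  assumes "k \<ge> 0" "norm N \<le> 1"
  shows "norm (stretch k N z) \<le> (1 + k) * norm z"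
proof -
  have "norm (stretch k N z) \<le> norm z + k * \<bar>N \<bullet> z\<bar> * norm N"
    unfolding stretch_def using assms by (intro norm_triangle_le) (simp add: abs_mult)
  also have "k * \<bar>N \<bullet> z\<bar> * norm N \<le> k * norm z * 1"
    using assms by (intro mult_mono inner_abs_le_norm_right) auto
  finally show ?thesis by (simp add: algebra_simps)
qed

text \<open>The form \<^term>\<open>stretch_sq k N z\<close> is the square of the norm of \<^term>\<open>(z, sqrt k * (N \<bullet> z))\<close> in a product space.\<close>

lemma stretch_Cauchy_Schwarz:
  assumes "k \<ge> 0"
  shows "(stretch k N z \<bullet> l)\<^sup>2 \<le> stretch_sq k N z * stretch_sq k N l"
proof -
  have *: "sqrt k * (sqrt k * x) = k * x" for x
    using assms by (simp flip: mult.assoc)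
  show ?thesis
    using Cauchy_Schwarz_ineq[of "(z, sqrt k * (N \<bullet> z))" "(l, sqrt k * (N \<bullet> l))"]
    by (simp add: * stretch_def stretch_sq_def inner_add_left power2_eq_square algebra_simps)
qed

text \<open>Cauchy-Schwarz for the cross term yields a factor \<open>sqrt q\<close>, that is, half a
  power of \<open>max 1 q\<close>; this brings the rank-one term to the scale of the
  \<open>p\<close>-Laplacian.\<close>

lemma powr_le_powr_half:
  fixes q :: real
  assumes "q \<ge> 0"
  shows "max 1 q powr ((p - 1) / 2 - 1) * sqrt q \<le> max 1 q powr ((p - 2) / 2)"
proof -
  have "max 1 q powr ((p - 1) / 2 - 1) * sqrt q \<le> max 1 q powr ((p - 1) / 2 - 1) * max 1 q powr (1 / 2)"
    using assms by (intro mult_left_mono) (auto simp: powr_half_sqrt)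
  also have "\<dots> = max 1 q powr ((p - 2) / 2)"
    by (simp add: field_simps flip: powr_add)
  finally show ?thesis .
qed

text \<open>The right side is the coefficient of the stretched \<open>p\<close>-Laplacian in the
  radial direction, where its derivative is weakest. For \<open>q \<ge> 1\<close> equality holds;
  for \<open>q \<le> 1\<close> the gap is linear in \<open>q\<close>, nonnegative, and zero at
  \<open>q = 1\<close>.\<close>

lemma powr_ext_monotone_bound:
  assumes "1 < p" "p < 2" "q \<ge> 0"
  shows "(p - 1) * max 1 q powr ((p - 2) / 2)
    \<le> powr_ext ((p - 2) / 2) q + (p - 2) * max 1 q powr ((p - 2) / 2 - 1) * q"
proof (cases "q \<le> 1")
  case True
  have "(2 - p) * q \<le> 2 - p"
    using assms True by (simp add: mult_left_le)
  then show ?thesis using True by (simp add: powr_ext_def field_simps)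
next
  case False
  have "q powr ((p - 2) / 2 - 1) * q = q powr ((p - 2) / 2)"
    using False powr_add[of q "(p - 2) / 2 - 1" 1] by simp
  then have "(p - 2) * q powr ((p - 2) / 2 - 1) * q = (p - 2) * q powr ((p - 2) / 2)"
    by (simp add: mult.assoc)
  then show ?thesis using False by (simp add: powr_ext_def algebra_simps)
qed

text \<open>The condition on \<open>k\<close> makes the stretched norm dominate \<open>2 * c * (N \<bullet> l)\<close>, so that the derivative of the
  rank-one term costs at most half of the ellipticity of the stretched \<open>p\<close>-Laplacian.\<close>

lemma vfield_deriv_elliptic:
  assumes p: "1 < p" "p < 2" and c: "c \<ge> 0" and k: "k \<ge> 4 * c\<^sup>2"
  shows "(p - 1) / 2 * max 1 (stretch_sq k N z) powr ((p - 2) / 2) * stretch_sq k N l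
    \<le> blinfun_apply (vfield_deriv p c k N z) l \<bullet> l"
proof -
  define q where "q = stretch_sq k N z"
  define \<Lambda> where "\<Lambda> = stretch_sq k N l"
  define A where "A = stretch k N z \<bullet> l"
  define b where "b = N \<bullet> l"
  define m where "m = max 1 q"
  have "k \<ge> 0" using k by (smt (verit) zero_le_power2)
  have "q \<ge> 0" "\<Lambda> \<ge> 0"
    using stretch_sq_nonneg[OF \<open>k \<ge> 0\<close>] by (auto simp: q_def \<Lambda>_def)
  have A: "A\<^sup>2 \<le> q * \<Lambda>"
    using stretch_Cauchy_Schwarz[OF \<open>k \<ge> 0\<close>] by (simp add: A_def q_def \<Lambda>_def)
  then have A': "\<bar>A\<bar> \<le> sqrt q * sqrt \<Lambda>"
    by (metis real_le_rsqrt real_sqrt_abs real_sqrt_le_iff real_sqrt_mult)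
  have "(2 * (c * b))\<^sup>2 \<le> \<Lambda>"
  proof -
    have "4 * c\<^sup>2 * b\<^sup>2 \<le> k * b\<^sup>2" using k by (rule mult_right_mono) simp
    also have "\<dots> \<le> \<Lambda>" by (simp add: \<Lambda>_def b_def stretch_sq_def)
    finally show ?thesis by (simp add: power_mult_distrib)
  qed
  then have b': "\<bar>2 * (c * b)\<bar> \<le> sqrt \<Lambda>"
    by (metis real_sqrt_abs real_sqrt_le_iff)
  \<comment> \<open>Since \<open>p - 2\<close> is negative, the Cauchy-Schwarz bound on
    \<open>A^2\<close> from above becomes a bound from below for this term.\<close>
  have "(p - 2) * m powr ((p - 2) / 2 - 1) * (q * \<Lambda>) \<le> (p - 2) * m powr ((p - 2) / 2 - 1) * A\<^sup>2"
    using A p by (intro mult_left_mono_neg) (auto simp: mult_nonpos_nonneg)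
  moreover have "(p - 1) * m powr ((p - 2) / 2) * \<Lambda>
    \<le> powr_ext ((p - 2) / 2) q * \<Lambda> + (p - 2) * m powr ((p - 2) / 2 - 1) * (q * \<Lambda>)"
    using mult_right_mono[OF powr_ext_monotone_bound[OF p \<open>q \<ge> 0\<close>] \<open>\<Lambda> \<ge> 0\<close>]
    by (simp only: m_def distrib_right mult.assoc)
  moreover have "\<bar>m powr ((p - 1) / 2 - 1) * (A * (2 * (c * b)))\<bar> \<le> m powr ((p - 2) / 2) * \<Lambda>"
  proof -
    have "\<bar>A * (2 * (c * b))\<bar> \<le> (sqrt q * sqrt \<Lambda>) * sqrt \<Lambda>"
      unfolding abs_mult[of A] using \<open>q \<ge> 0\<close> \<open>\<Lambda> \<ge> 0\<close> by (intro mult_mono A' b') auto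
    then have "\<bar>m powr ((p - 1) / 2 - 1) * (A * (2 * (c * b)))\<bar> \<le> m powr ((p - 1) / 2 - 1) * (sqrt q * \<Lambda>)"
      using \<open>\<Lambda> \<ge> 0\<close> by (subst abs_mult) (auto intro!: mult_left_mono simp: mult.assoc)
    also have "\<dots> \<le> m powr ((p - 2) / 2) * \<Lambda>"
      using mult_right_mono[OF powr_le_powr_half[OF \<open>q \<ge> 0\<close>, of p] \<open>\<Lambda> \<ge> 0\<close>] by (simp add: m_def mult.assoc)
    finally show ?thesis .
  qed
  \<comment> \<open>The cross term carries \<open>c * (p - 1) = (p - 1) / 2 * (2 * c)\<close>, and
    \<open>2 * c * b\<close> was bounded by \<open>sqrt \<Lambda>\<close>; hence the loss is at most
    half of the available \<open>p - 1\<close>.\<close>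
  then have "(p - 1) / 2 * - (m powr ((p - 2) / 2) * \<Lambda>)
      \<le> (p - 1) / 2 * (m powr ((p - 1) / 2 - 1) * (A * (2 * (c * b))))"
    using p by (intro mult_left_mono) auto
  moreover have "blinfun_apply (vfield_deriv p c k N z) l \<bullet> l
    = powr_ext ((p - 2) / 2) q * \<Lambda> + (p - 2) * m powr ((p - 2) / 2 - 1) * A\<^sup>2
      + (p - 1) / 2 * (m powr ((p - 1) / 2 - 1) * (A * (2 * (c * b))))"
    by (simp add: vfield_deriv_apply inner_add_left inner_stretch q_def \<Lambda>_def A_def b_def m_def power2_eq_square)
  moreover have "(p - 1) * m powr ((p - 2) / 2) * \<Lambda> = 2 * ((p - 1) / 2 * m powr ((p - 2) / 2) * \<Lambda>)"
    "(p - 1) / 2 * - (m powr ((p - 2) / 2) * \<Lambda>) = - ((p - 1) / 2 * m powr ((p - 2) / 2) * \<Lambda>)"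
    by simp_all
  ultimately show ?thesis
    unfolding q_def[symmetric] \<Lambda>_def[symmetric] m_def[symmetric] by linarith
qed

section \<open>Growth and Lipschitz estimates in powers of \<open>1 + norm z\<close>\<close>

lemma power2_powr_half: "x > 0 \<Longrightarrow> (x\<^sup>2) powr (a / 2) = x powr a" for x :: real
  using powr_powr[of x 2 "a / 2"] by simp

text \<open>With a negative exponent a lower bound on the base is needed:
  \<open>((1 + x) / 2)^2 \<le> max 1 (x^2)\<close>. The halving costs \<open>2 powr (2 - p)\<close>,
  which is at most 2.\<close>

lemma max_sq_powr_le:
  fixes x :: real
  assumes "1 < p" "p < 2" "x \<ge> 0"
  shows "max 1 (x\<^sup>2) powr ((p - 2) / 2) \<le> 2 * (1 + x) powr (p - 2)"
proof -
  have "((1 + x) / 2)\<^sup>2 \<le> max 1 (x\<^sup>2)"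
  proof -
    have "0 \<le> (1 - x)\<^sup>2" by simp
    then have "(1 + x)\<^sup>2 \<le> 2 + 2 * x\<^sup>2" by (simp add: power2_eq_square algebra_simps)
    then show ?thesis by (simp add: power_divide)
  qed
  then have "max 1 (x\<^sup>2) powr ((p - 2) / 2) \<le> (((1 + x) / 2)\<^sup>2) powr ((p - 2) / 2)"
    using assms by (intro powr_mono2') auto
  also have "\<dots> = ((1 + x) / 2) powr (p - 2)"
    using assms by (intro power2_powr_half) auto
  also have "\<dots> = 2 powr (2 - p) * (1 + x) powr (p - 2)"
    using assms powr_minus_divide[of 2 "p - 2"] by (simp add: powr_divide)
  also have "\<dots> \<le> 2 powr 1 * (1 + x) powr (p - 2)"
    using assms by (intro mult_right_mono powr_mono) auto
  finally show ?thesis by simp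
qed

lemma max_stretch_sq_le:
  assumes "k \<ge> 0" "norm N \<le> 1"
  shows "max 1 (stretch_sq k N z) \<le> (1 + k) * (1 + norm z)\<^sup>2"
proof -
  have "1 * 1 \<le> (1 + k) * (1 + norm z)\<^sup>2"
    using assms by (intro mult_mono one_le_power) auto
  moreover have "(1 + k) * (norm z)\<^sup>2 \<le> (1 + k) * (1 + norm z)\<^sup>2"
    using assms by (intro mult_left_mono power_mono) auto
  ultimately show ?thesis using stretch_sq_le[OF assms, of z] by simp
qed

lemma max_stretch_sq_powr_le_pos:
  assumes "1 < p" "p < 2" "k \<ge> 0" "norm N \<le> 1"
  shows "max 1 (stretch_sq k N z) powr ((p - 1) / 2) \<le> (1 + k) * (1 + norm z) powr (p - 1)"
proof -
  have "max 1 (stretch_sq k N z) powr ((p - 1) / 2) \<le> ((1 + k) * (1 + norm z)\<^sup>2) powr ((p - 1) / 2)"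
    using assms max_stretch_sq_le[of k N z] by (intro powr_mono2) auto
  also have "\<dots> = (1 + k) powr ((p - 1) / 2) * (1 + norm z) powr (p - 1)"
    using assms by (simp add: powr_mult power2_powr_half add_pos_nonneg)
  also have "\<dots> \<le> (1 + k) powr 1 * (1 + norm z) powr (p - 1)"
    using assms by (intro mult_right_mono powr_mono) auto
  finally show ?thesis using assms by simp
qed

text \<open>The exponent is negative, so the upper bound on the stretched square, with its factor
  \<open>1 + k\<close>, produces the lower bound. This power of \<open>1 + k\<close> ends up in the
  ellipticity constant.\<close>

lemma max_stretch_sq_powr_ge:
  assumes "1 < p" "p < 2" "k \<ge> 0" "norm N \<le> 1"
  shows "(1 + k) powr ((p - 2) / 2) * (1 + norm z) powr (p - 2) \<le> max 1 (stretch_sq k N z) powr ((p - 2) / 2)"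
proof -
  have "(1 + k) powr ((p - 2) / 2) * (1 + norm z) powr (p - 2) = ((1 + k) * (1 + norm z)\<^sup>2) powr ((p - 2) / 2)"
    using assms by (simp add: powr_mult power2_powr_half add_pos_nonneg)
  also have "\<dots> \<le> max 1 (stretch_sq k N z) powr ((p - 2) / 2)"
    using assms max_stretch_sq_le[of k N z] by (intro powr_mono2') auto
  finally show ?thesis .
qed

lemma max_stretch_sq_powr_le_neg:
  assumes "1 < p" "p < 2" "k \<ge> 0"
  shows "max 1 (stretch_sq k N z) powr ((p - 2) / 2) \<le> max 1 ((norm z)\<^sup>2) powr ((p - 2) / 2)"
    "max 1 (stretch_sq k N z) powr ((p - 2) / 2) \<le> 2 * (1 + norm z) powr (p - 2)"
proof -
  show "max 1 (stretch_sq k N z) powr ((p - 2) / 2) \<le> max 1 ((norm z)\<^sup>2) powr ((p - 2) / 2)"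
    using assms stretch_sq_ge[of k z N] by (intro powr_mono2') auto
  also have "\<dots> \<le> 2 * (1 + norm z) powr (p - 2)"
    using assms by (intro max_sq_powr_le) auto
  finally show "max 1 (stretch_sq k N z) powr ((p - 2) / 2) \<le> 2 * (1 + norm z) powr (p - 2)" .
qed

lemma powr_minus_one_mult_le:
  fixes y w :: real
  assumes "w > 0" "y \<le> w" "0 \<le> y"
  shows "w powr (p - 2) * y \<le> w powr (p - 1)"
proof -
  have "w powr (p - 2) * y \<le> w powr (p - 2) * w"
    using assms by (intro mult_left_mono) auto
  also have "\<dots> = w powr (p - 1)"
    using assms powr_add[of w "p - 2" 1] by simp
  finally show ?thesis .
qed

lemma vfield_growth:
  assumes p: "1 < p" "p < 2" and c: "c \<ge> 0" and k: "k \<ge> 0" and N: "norm N \<le> 1"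
  shows "norm (vfield p c k N z) \<le> (4 + c) * (1 + k) * (1 + norm z) powr (p - 1)"
proof -
  define q where "q = stretch_sq k N z"
  define W where "W = (1 + norm z) powr (p - 1)"
  have q: "q \<ge> 0" unfolding q_def by (rule stretch_sq_nonneg[OF k])
  \<comment> \<open>The final 4 is \<open>2 * 2\<close>: one 2 bounds \<open>1 - e\<close> for
    \<open>e = (p - 2) / 2\<close>, the other comes from replacing \<open>max 1 q\<close> by
    \<open>1 + norm z\<close>.\<close>
  have "powr_ext ((p - 2) / 2) q \<le> 2 * max 1 q powr ((p - 2) / 2)"
    using powr_ext_bounds_neg(2)[of "(p - 2) / 2" q] p q
      mult_right_mono[of "1 - (p - 2) / 2" 2 "max 1 q powr ((p - 2) / 2)"] by simp
  also have "\<dots> \<le> 4 * (1 + norm z) powr (p - 2)"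
    using max_stretch_sq_powr_le_neg(2)[OF p k, of N z] by (simp add: q_def)
  finally have \<psi>: "powr_ext ((p - 2) / 2) q \<le> 4 * (1 + norm z) powr (p - 2)" .
  have \<psi>0: "powr_ext ((p - 2) / 2) q \<ge> 0"
    using powr_ext_bounds_neg(1)[of "(p - 2) / 2" q] p q by (intro order_trans[OF powr_ge_zero]) auto
  have P: "powr_ext ((p - 1) / 2) q \<le> (1 + k) * W" "powr_ext ((p - 1) / 2) q \<ge> 0"
    using powr_ext_bounds_pos[of "(p - 1) / 2" q] p q max_stretch_sq_powr_le_pos[OF p k N, of z]
    by (auto simp: q_def W_def)
  have "norm (powr_ext ((p - 2) / 2) q *\<^sub>R stretch k N z)
      \<le> (4 * (1 + norm z) powr (p - 2)) * ((1 + k) * norm z)"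
    using \<psi> \<psi>0 norm_stretch_le[OF k N, of z] by (simp add: mult_mono)
  also have "\<dots> = 4 * (1 + k) * ((1 + norm z) powr (p - 2) * norm z)"
    by simp
  also have "\<dots> \<le> 4 * (1 + k) * W"
    unfolding W_def using k by (intro mult_left_mono powr_minus_one_mult_le) (auto simp: add_pos_nonneg)
  finally have 1: "norm (powr_ext ((p - 2) / 2) q *\<^sub>R stretch k N z) \<le> 4 * (1 + k) * W" .
  have "norm ((c * powr_ext ((p - 1) / 2) q) *\<^sub>R N) \<le> (c * ((1 + k) * W)) * 1"
    unfolding norm_scaleR using P c N by (intro mult_mono) (auto simp: mult_left_mono)
  then have "norm (vfield p c k N z) \<le> 4 * (1 + k) * W + c * ((1 + k) * W)"
    unfolding vfield_def using 1 by (intro norm_triangle_le) (simp add: q_def)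
  then show ?thesis by (simp add: W_def algebra_simps)
qed

text \<open>Each of the three terms of the derivative is a multiple of \<open>E\<close>: the
  coefficients 2, 1 and \<open>c\<close> add up to \<open>3 + c\<close>. Every stretch costs
  \<open>1 + k\<close> and at most two occur in one term; the powers of \<open>norm z\<close> they
  leave are absorbed by the lower exponents of \<open>m\<close>. The outer 2 is the passage from
  \<open>E\<close> to \<open>1 + norm z\<close>.\<close>

lemma vfield_deriv_growth:
  assumes p: "1 < p" "p < 2" and c: "c \<ge> 0" and k: "k \<ge> 0" and N: "norm N \<le> 1"
  shows "norm (vfield_deriv p c k N z) * (1 + norm z) \<le> 2 * (3 + c) * (1 + k)\<^sup>2 * (1 + norm z) powr (p - 1)"
proof -
  define q where "q = stretch_sq k N z"
  define m where "m = max 1 q"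
  define E where "E = m powr ((p - 2) / 2)"
  have q: "q \<ge> 0" unfolding q_def by (rule stretch_sq_nonneg[OF k])
  have "m \<ge> 1" by (simp add: m_def)
  have zq: "(norm z)\<^sup>2 \<le> q" unfolding q_def by (rule stretch_sq_ge[OF k])
  then have zsq: "norm z \<le> sqrt q" by (simp add: real_le_rsqrt)
  have "E \<ge> 0" by (simp add: E_def)
  have \<psi>: "\<bar>powr_ext ((p - 2) / 2) q\<bar> \<le> 2 * E"
  proof -
    have "powr_ext ((p - 2) / 2) q \<le> 2 * E"
      using powr_ext_bounds_neg(2)[of "(p - 2) / 2" q] p q
        mult_right_mono[of "1 - (p - 2) / 2" 2 E] by (simp add: E_def m_def)
    then show ?thesis
      using powr_ext_bounds_neg(1)[of "(p - 2) / 2" q] p q \<open>E \<ge> 0\<close> by (simp add: E_def m_def)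
  qed
  have d1: "\<bar>(p - 2) * m powr ((p - 2) / 2 - 1)\<bar> * (norm z)\<^sup>2 \<le> E"
  proof -
    have "\<bar>(p - 2) * m powr ((p - 2) / 2 - 1)\<bar> \<le> 1 * m powr ((p - 2) / 2 - 1)"
      unfolding abs_mult using p by (intro mult_mono) auto
    moreover have "(norm z)\<^sup>2 \<le> m" using zq by (simp add: m_def)
    ultimately have "\<bar>(p - 2) * m powr ((p - 2) / 2 - 1)\<bar> * (norm z)\<^sup>2 \<le> m powr ((p - 2) / 2 - 1) * m"
      by (intro mult_mono) auto
    also have "\<dots> = E"
      using \<open>m \<ge> 1\<close> powr_add[of m "(p - 2) / 2 - 1" 1] by (simp add: E_def)
    finally show ?thesis .
  qed
  have d2: "\<bar>c * (p - 1) * m powr ((p - 1) / 2 - 1)\<bar> * norm z \<le> c * E"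
  proof -
    have "m powr ((p - 1) / 2 - 1) * norm z \<le> m powr ((p - 1) / 2 - 1) * sqrt q"
      using zsq by (intro mult_left_mono) auto
    also have "\<dots> \<le> E"
      unfolding E_def m_def using q by (rule powr_le_powr_half)
    finally have "c * ((p - 1) * (m powr ((p - 1) / 2 - 1) * norm z)) \<le> c * (1 * E)"
      using p c by (intro mult_left_mono mult_mono) auto
    then show ?thesis using p c by (simp add: abs_mult mult.assoc)
  qed
  have "norm (vfield_deriv p c k N z) \<le> (3 + c) * (1 + k)\<^sup>2 * E"
  proof (rule norm_blinfun_bound)
    show "0 \<le> (3 + c) * (1 + k)\<^sup>2 * E" using c \<open>E \<ge> 0\<close> by simp
    fix l
    let ?s = "stretch k N z"
    have sl: "\<bar>?s \<bullet> l\<bar> \<le> (1 + k) * norm z * norm l"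
      using Cauchy_Schwarz_ineq2[of ?s l] mult_right_mono[OF norm_stretch_le[OF k N, of z], of "norm l"] by simp
    have "norm (powr_ext ((p - 2) / 2) q *\<^sub>R stretch k N l) \<le> 2 * E * ((1 + k) * norm l)"
      using \<psi> norm_stretch_le[OF k N, of l] \<open>E \<ge> 0\<close> k by (simp add: mult_mono)
    also have "\<dots> \<le> 2 * (1 + k)\<^sup>2 * E * norm l"
    proof -
      have "1 + k \<le> (1 + k)\<^sup>2" using k by (simp add: power2_eq_square algebra_simps)
      then have "(1 + k) * (2 * E * norm l) \<le> (1 + k)\<^sup>2 * (2 * E * norm l)"
        using \<open>E \<ge> 0\<close> by (intro mult_right_mono) auto
      then show ?thesis by (simp add: mult_ac)
    qed
    finally have 1: "norm (powr_ext ((p - 2) / 2) q *\<^sub>R stretch k N l) \<le> 2 * (1 + k)\<^sup>2 * E * norm l" .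
    have "norm (((p - 2) * m powr ((p - 2) / 2 - 1) * (?s \<bullet> l)) *\<^sub>R ?s)
        = \<bar>(p - 2) * m powr ((p - 2) / 2 - 1)\<bar> * (\<bar>?s \<bullet> l\<bar> * norm ?s)"
      by (simp add: abs_mult)
    also have "\<dots> \<le> \<bar>(p - 2) * m powr ((p - 2) / 2 - 1)\<bar> * (((1 + k) * norm z * norm l) * ((1 + k) * norm z))"
      using k by (intro mult_left_mono mult_mono sl norm_stretch_le[OF k N]) auto
    also have "\<dots> = (1 + k)\<^sup>2 * norm l * (\<bar>(p - 2) * m powr ((p - 2) / 2 - 1)\<bar> * (norm z)\<^sup>2)"
      by (simp add: power2_eq_square)
    also have "\<dots> \<le> (1 + k)\<^sup>2 * norm l * E"
      by (intro mult_left_mono d1) auto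
    finally have 2: "norm (((p - 2) * m powr ((p - 2) / 2 - 1) * (?s \<bullet> l)) *\<^sub>R ?s) \<le> (1 + k)\<^sup>2 * norm l * E" .
    have "norm ((c * (p - 1) * m powr ((p - 1) / 2 - 1) * (?s \<bullet> l)) *\<^sub>R N)
        = \<bar>c * (p - 1) * m powr ((p - 1) / 2 - 1)\<bar> * (\<bar>?s \<bullet> l\<bar> * norm N)"
      by (simp add: abs_mult)
    also have "\<dots> \<le> \<bar>c * (p - 1) * m powr ((p - 1) / 2 - 1)\<bar> * (((1 + k) * norm z * norm l) * 1)"
      using k by (intro mult_left_mono mult_mono sl N) auto
    also have "\<dots> = (1 + k) * norm l * (\<bar>c * (p - 1) * m powr ((p - 1) / 2 - 1)\<bar> * norm z)"
      by simp
    also have "\<dots> \<le> (1 + k) * norm l * (c * E)"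
      using k by (intro mult_left_mono d2) auto
    also have "\<dots> \<le> (1 + k)\<^sup>2 * norm l * (c * E)"
      using k c \<open>E \<ge> 0\<close> by (intro mult_right_mono) (auto simp: power2_eq_square algebra_simps)
    finally have 3: "norm ((c * (p - 1) * m powr ((p - 1) / 2 - 1) * (?s \<bullet> l)) *\<^sub>R N) \<le> (1 + k)\<^sup>2 * norm l * (c * E)" .
    show "norm (blinfun_apply (vfield_deriv p c k N z) l) \<le> (3 + c) * (1 + k)\<^sup>2 * E * norm l"
      unfolding vfield_deriv_apply q_def[symmetric] m_def[symmetric]
      by (rule order_trans[OF norm_triangle_mono[OF norm_triangle_mono[OF 1 2] 3]]) (simp add: algebra_simps)
  qed
  also have "\<dots> \<le> (3 + c) * (1 + k)\<^sup>2 * (2 * (1 + norm z) powr (p - 2))"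
    unfolding E_def m_def q_def using c by (intro mult_left_mono max_stretch_sq_powr_le_neg(2) p k) auto
  finally have "norm (vfield_deriv p c k N z) * (1 + norm z)
      \<le> (3 + c) * (1 + k)\<^sup>2 * (2 * (1 + norm z) powr (p - 2)) * (1 + norm z)"
    by (rule mult_right_mono) simp
  also have "\<dots> = 2 * (3 + c) * (1 + k)\<^sup>2 * ((1 + norm z) powr (p - 2) * (1 + norm z))"
    by (simp add: algebra_simps)
  also have "\<dots> \<le> 2 * (3 + c) * (1 + k)\<^sup>2 * (1 + norm z) powr (p - 1)"
    using c by (intro mult_left_mono powr_minus_one_mult_le) (auto simp: add_pos_nonneg)
  finally show ?thesis .
qed

text \<open>The field depends on \<open>N\<close> through the stretch, through the stretched square
  and as an explicit factor. The stretched square changes by an amount of order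
  \<open>(norm z)^2\<close> times the distance of the \<open>N\<close>, but the slope of
  \<open>powr_ext\<close> is one power of \<open>m\<close> lower, so every change has growth
  \<open>p - 1\<close> in \<open>1 + norm z\<close>.\<close>

lemma vfield_Lipschitz:
  assumes p: "1 < p" "p < 2" and c: "c \<ge> 0" and k: "k \<ge> 0" and N: "norm N \<le> 1" "norm N' \<le> 1"
  shows "norm (vfield p c k N z - vfield p c k N' z)
    \<le> (10 + 3 * c) * (1 + k)\<^sup>2 * (1 + norm z) powr (p - 1) * norm (N - N')"
proof -
  define q where "q = stretch_sq k N z"
  define q' where "q' = stretch_sq k N' z"
  define d where "d = norm (N - N')"
  \<comment> \<open>Independent of \<open>N\<close> and below both \<open>max 1 q\<close> and
    \<open>max 1 q'\<close>, so one power of \<open>m\<close> controls the slopes on the whole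
    segment between \<open>q\<close> and \<open>q'\<close>.\<close>
  define m where "m = max 1 ((norm z)\<^sup>2)"
  define w where "w = 1 + norm z"
  define W where "W = w powr (p - 1)"
  have w: "w > 0" "norm z \<le> w" by (auto simp: w_def add_pos_nonneg)
  have "W \<ge> 0" "d \<ge> 0" by (auto simp: W_def d_def)
  have q: "q \<ge> (norm z)\<^sup>2" "q' \<ge> (norm z)\<^sup>2" "q \<ge> 0" "q' \<ge> 0"
    using stretch_sq_ge[OF k] stretch_sq_nonneg[OF k] by (auto simp: q_def q'_def)
  have Nz: "\<bar>N \<bullet> z - N' \<bullet> z\<bar> \<le> d * norm z"
    using Cauchy_Schwarz_ineq2[of "N - N'" z] by (simp add: d_def inner_diff_left)
  have qq: "\<bar>q - q'\<bar> \<le> 2 * k * (norm z)\<^sup>2 * d"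
  proof -
    have "q - q' = k * ((N \<bullet> z - N' \<bullet> z) * (N \<bullet> z + N' \<bullet> z))"
      by (simp add: q_def q'_def stretch_sq_def power2_eq_square algebra_simps)
    moreover have "\<bar>N \<bullet> z + N' \<bullet> z\<bar> \<le> 2 * norm z"
      using inner_abs_le_norm_right[OF N(1), of z] inner_abs_le_norm_right[OF N(2), of z] by linarith
    then have "\<bar>(N \<bullet> z - N' \<bullet> z) * (N \<bullet> z + N' \<bullet> z)\<bar> \<le> (d * norm z) * (2 * norm z)"
      unfolding abs_mult using \<open>d \<ge> 0\<close> by (intro mult_mono Nz) auto
    ultimately show ?thesis
      using mult_left_mono[of _ _ k] k by (fastforce simp: abs_mult power2_eq_square mult_ac)
  qed
  have mE: "m powr ((p - 2) / 2) \<le> 2 * w powr (p - 2)"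
    unfolding m_def w_def by (rule max_sq_powr_le[OF p]) simp
  have mF: "m powr ((p - 1) / 2) \<le> W"
  proof -
    have "m \<le> w\<^sup>2" by (auto simp: m_def w_def power2_eq_square algebra_simps)
    then have "m powr ((p - 1) / 2) \<le> (w\<^sup>2) powr ((p - 1) / 2)"
      using p by (intro powr_mono2) (auto simp: m_def)
    also have "\<dots> = W"
      using w by (simp add: W_def power2_powr_half)
    finally show ?thesis .
  qed
  have mz: "m powr (e - 1) * (norm z)\<^sup>2 \<le> m powr e" for e
  proof -
    have "m powr (e - 1) * (norm z)\<^sup>2 \<le> m powr (e - 1) * m"
      by (intro mult_left_mono) (auto simp: m_def)
    also have "\<dots> = m powr e"
      using powr_add[of m "e - 1" 1] by (simp add: m_def)
    finally show ?thesis .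
  qed
  \<comment> \<open>Both exponents in use, \<open>(p - 2) / 2\<close> and
    \<open>(p - 1) / 2\<close>, have absolute value at most 1/2, which cancels the 2 in the bound
    for the difference of squares.\<close>
  have diff: "\<bar>powr_ext e q - powr_ext e q'\<bar> \<le> k * m powr e * d" if "\<bar>e\<bar> \<le> 1 / 2" for e
  proof -
    have "\<bar>powr_ext e q - powr_ext e q'\<bar> \<le> \<bar>e\<bar> * m powr (e - 1) * \<bar>q - q'\<bar>"
      unfolding m_def using that q by (intro powr_ext_diff_le) auto
    also have "\<dots> \<le> 1 / 2 * m powr (e - 1) * (2 * k * (norm z)\<^sup>2 * d)"
      using that by (intro mult_mono qq) auto
    also have "\<dots> = k * d * (m powr (e - 1) * (norm z)\<^sup>2)"
      by simp
    also have "\<dots> \<le> k * d * m powr e"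
      using k \<open>d \<ge> 0\<close> by (intro mult_left_mono mz) auto
    finally show ?thesis by (simp add: mult_ac)
  qed
  have \<psi>: "\<bar>powr_ext ((p - 2) / 2) q\<bar> \<le> 4 * w powr (p - 2)"
  proof -
    have "powr_ext ((p - 2) / 2) q \<le> 2 * max 1 q powr ((p - 2) / 2)"
      using powr_ext_bounds_neg(2)[of "(p - 2) / 2" q] p q
        mult_right_mono[of "1 - (p - 2) / 2" 2 "max 1 q powr ((p - 2) / 2)"] by simp
    moreover have "max 1 q powr ((p - 2) / 2) \<le> 2 * w powr (p - 2)"
      unfolding q_def w_def by (rule max_stretch_sq_powr_le_neg(2)[OF p k])
    moreover have "0 \<le> powr_ext ((p - 2) / 2) q"
      using powr_ext_bounds_neg(1)[of "(p - 2) / 2" q] p q by (intro order_trans[OF powr_ge_zero]) auto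
    ultimately show ?thesis by simp
  qed
  have P: "\<bar>powr_ext ((p - 1) / 2) q'\<bar> \<le> (1 + k) * W"
    using powr_ext_bounds_pos[of "(p - 1) / 2" q'] p q max_stretch_sq_powr_le_pos[OF p k N(2), of z]
    by (auto simp: q'_def W_def w_def)
  have wz: "w powr (p - 2) * norm z \<le> W"
    unfolding W_def using w by (intro powr_minus_one_mult_le) auto
  have s: "norm (stretch k N z - stretch k N' z) \<le> 2 * k * norm z * d"
  proof -
    have "stretch k N z - stretch k N' z = k *\<^sub>R ((N \<bullet> z) *\<^sub>R (N - N') + (N \<bullet> z - N' \<bullet> z) *\<^sub>R N')"
      by (simp add: stretch_def algebra_simps)
    moreover have "norm ((N \<bullet> z) *\<^sub>R (N - N')) \<le> norm z * d"
      using inner_abs_le_norm_right[OF N(1), of z] by (simp add: d_def mult_right_mono)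
    moreover have "norm ((N \<bullet> z - N' \<bullet> z) *\<^sub>R N') \<le> (d * norm z) * 1"
      unfolding norm_scaleR using Nz N \<open>d \<ge> 0\<close> by (intro mult_mono) auto
    ultimately have "norm (stretch k N z - stretch k N' z) \<le> k * (norm z * d + d * norm z)"
      using k norm_triangle_mono by (fastforce intro: mult_left_mono)
    then show ?thesis by (simp add: mult_ac)
  qed
  have t1: "norm (powr_ext ((p - 2) / 2) q *\<^sub>R (stretch k N z - stretch k N' z)) \<le> 8 * k * W * d"
  proof -
    have "norm (powr_ext ((p - 2) / 2) q *\<^sub>R (stretch k N z - stretch k N' z))
        \<le> (4 * w powr (p - 2)) * (2 * k * norm z * d)"
      unfolding norm_scaleR by (intro mult_mono \<psi> s) auto
    also have "\<dots> = 8 * k * d * (w powr (p - 2) * norm z)" by simp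
    also have "\<dots> \<le> 8 * k * d * W"
      using k \<open>d \<ge> 0\<close> by (intro mult_left_mono wz) auto
    finally show ?thesis by (simp add: mult_ac)
  qed
  have t2: "norm ((powr_ext ((p - 2) / 2) q - powr_ext ((p - 2) / 2) q') *\<^sub>R stretch k N' z)
      \<le> 2 * k * (1 + k) * W * d"
  proof -
    have "\<bar>powr_ext ((p - 2) / 2) q - powr_ext ((p - 2) / 2) q'\<bar> \<le> k * m powr ((p - 2) / 2) * d"
      using p by (intro diff) auto
    also have "\<dots> \<le> k * (2 * w powr (p - 2)) * d"
      using k \<open>d \<ge> 0\<close> by (intro mult_right_mono mult_left_mono mE) auto
    finally have "norm ((powr_ext ((p - 2) / 2) q - powr_ext ((p - 2) / 2) q') *\<^sub>R stretch k N' z)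
        \<le> (k * (2 * w powr (p - 2)) * d) * ((1 + k) * norm z)"
      unfolding norm_scaleR real_norm_def using k \<open>d \<ge> 0\<close> by (intro mult_mono norm_stretch_le N) auto
    also have "\<dots> = 2 * k * (1 + k) * d * (w powr (p - 2) * norm z)" by simp
    also have "\<dots> \<le> 2 * k * (1 + k) * d * W"
      using k \<open>d \<ge> 0\<close> by (intro mult_left_mono wz) auto
    finally show ?thesis by (simp add: mult_ac)
  qed
  have t3: "norm ((c * (powr_ext ((p - 1) / 2) q - powr_ext ((p - 1) / 2) q')) *\<^sub>R N) \<le> c * (k * W * d)"
  proof -
    have "\<bar>powr_ext ((p - 1) / 2) q - powr_ext ((p - 1) / 2) q'\<bar> \<le> k * m powr ((p - 1) / 2) * d"
      using p by (intro diff) auto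
    also have "\<dots> \<le> k * W * d"
      using k \<open>d \<ge> 0\<close> by (intro mult_right_mono mult_left_mono mF) auto
    finally have "norm ((c * (powr_ext ((p - 1) / 2) q - powr_ext ((p - 1) / 2) q')) *\<^sub>R N) \<le> (c * (k * W * d)) * 1"
      unfolding norm_scaleR real_norm_def abs_mult using c k N \<open>d \<ge> 0\<close> \<open>W \<ge> 0\<close>
      by (intro mult_mono) auto
    then show ?thesis by simp
  qed
  have t4: "norm ((c * powr_ext ((p - 1) / 2) q') *\<^sub>R (N - N')) \<le> c * ((1 + k) * W) * d"
    unfolding norm_scaleR real_norm_def abs_mult d_def using c k \<open>W \<ge> 0\<close> by (intro mult_mono P) auto
  \<comment> \<open>Telescoping: one occurrence of \<open>N\<close> is changed to \<open>N'\<close>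
    at a time.\<close>
  have "vfield p c k N z - vfield p c k N' z =
      powr_ext ((p - 2) / 2) q *\<^sub>R (stretch k N z - stretch k N' z)
    + (powr_ext ((p - 2) / 2) q - powr_ext ((p - 2) / 2) q') *\<^sub>R stretch k N' z
    + (c * (powr_ext ((p - 1) / 2) q - powr_ext ((p - 1) / 2) q')) *\<^sub>R N
    + (c * powr_ext ((p - 1) / 2) q') *\<^sub>R (N - N')"
    by (simp add: vfield_def q_def q'_def algebra_simps)
  also have "norm \<dots> \<le> 8 * k * W * d + 2 * k * (1 + k) * W * d + c * (k * W * d) + c * ((1 + k) * W) * d"
    by (intro norm_triangle_mono t1 t2 t3 t4)
  also have "\<dots> = (8 * k + 2 * k * (1 + k) + c * k + c * (1 + k)) * (W * d)"
    by (simp add: algebra_simps)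
  also have "\<dots> \<le> (10 + 3 * c) * (1 + k)\<^sup>2 * (W * d)"
  proof (rule mult_right_mono)
    have "(10 + 3 * c) * (1 + k)\<^sup>2 - (8 * k + 2 * k * (1 + k) + c * k + c * (1 + k))
        = 10 + 10 * k + 8 * k\<^sup>2 + c * (2 + 4 * k + 3 * k\<^sup>2)"
      by (simp add: power2_eq_square algebra_simps)
    also have "\<dots> \<ge> 0" using c k by simp
    finally show "8 * k + 2 * k * (1 + k) + c * k + c * (1 + k) \<le> (10 + 3 * c) * (1 + k)\<^sup>2" by simp
  qed (use \<open>W \<ge> 0\<close> \<open>d \<ge> 0\<close> in simp)
  finally show ?thesis
    by (simp add: W_def w_def d_def mult.assoc)
qed

section \<open>The radial map and its flux\<close>

definition outer :: "real^'n \<Rightarrow> real^'m \<Rightarrow> real^'m^'n" where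
  "outer x y = (\<chi> i. x $ i *\<^sub>R y)"

lemma inner_outer: "outer x y \<bullet> outer x' y' = (x \<bullet> x') * (y \<bullet> y')"
  by (simp add: outer_def inner_vec_def[of "vec_lambda _"] inner_vec_def[of x x'] sum_distrib_left mult_ac)

lemma norm_outer: "norm (outer x y) = norm x * norm y"
  by (simp add: norm_eq_sqrt_inner inner_outer real_sqrt_mult)

lemma continuous_on_outer [continuous_intros]:
  "continuous_on S f \<Longrightarrow> continuous_on S g \<Longrightarrow> continuous_on S (\<lambda>x. outer (f x) (g x))"
  unfolding outer_def by (intro continuous_intros)

text \<open>A bounded Lipschitz extension of \<open>n \<mapsto> outer n n\<close> from the unit circle to the whole plane.\<close>

definition direction :: "real^'n \<Rightarrow> real^'n^'n" where
  "direction v = outer (closest_point (cball 0 1) v) (closest_point (cball 0 1) v)"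

lemma norm_closest_point_cball: "norm (closest_point (cball 0 1) (v::'a::euclidean_space)) \<le> 1"
  using closest_point_in_set[of "cball (0::'a) 1" v] by simp

lemma norm_direction_le: "norm (direction v) \<le> 1"
  using norm_closest_point_cball[of v] by (simp add: direction_def norm_outer mult_le_one)

text \<open>Projection onto a convex set does not increase distances, and the outer square of a
  vector in the unit ball at most doubles them.\<close>

lemma direction_Lipschitz: "norm (direction v - direction w) \<le> 2 * norm (v - w)"
proof -
  let ?v = "closest_point (cball 0 1) v" and ?w = "closest_point (cball 0 1) w"
  have d: "norm (?v - ?w) \<le> norm (v - w)"
    using closest_point_lipschitz[of "cball 0 1" v w] by (simp add: dist_norm)
  have "direction v - direction w = outer ?v (?v - ?w) + outer (?v - ?w) ?w"
    by (simp add: direction_def outer_def vec_eq_iff algebra_simps)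
  also have "norm \<dots> \<le> norm ?v * norm (?v - ?w) + norm (?v - ?w) * norm ?w"
    by (metis norm_outer norm_triangle_ineq)
  also have "\<dots> \<le> 1 * norm (v - w) + norm (v - w) * 1"
    by (intro add_mono mult_mono norm_closest_point_cball d) auto
  finally show ?thesis by simp
qed

text \<open>The difference is at most 2 and at most twice the distance; for distances below 1 any
  power with exponent below 1 is larger than the distance. The constant 2 serves all
  \<open>\<alpha>\<close>.\<close>

lemma direction_Hoelder:
  assumes "0 < \<alpha>" "\<alpha> < 1"
  shows "norm (direction v - direction w) \<le> 2 * min 1 (norm (v - w) powr \<alpha>)"
proof (cases "norm (v - w) \<le> 1")
  case True
  then have "norm (v - w) powr 1 \<le> norm (v - w) powr \<alpha>"
    using assms by (intro powr_mono') auto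
  moreover have "norm (v - w) powr \<alpha> \<le> 1"
    using True assms by (intro powr_le1) auto
  ultimately show ?thesis using direction_Lipschitz[of v w] by simp
next
  case False
  then have "1 \<le> norm (v - w) powr \<alpha>"
    using assms by (intro ge_one_powr_ge_zero) auto
  moreover have "norm (direction v - direction w) \<le> 1 + 1"
    using norm_triangle_le_diff[OF add_mono[OF norm_direction_le norm_direction_le]] by blast
  ultimately show ?thesis by simp
qed

lemma direction_unit: "norm x = 1 \<Longrightarrow> direction x = outer x x"
  by (simp add: direction_def closest_point_self)

lemma continuous_on_direction [continuous_intros]:
  "continuous_on S f \<Longrightarrow> continuous_on S (\<lambda>x. direction (f x))"
proof -
  have "continuous_on UNIV (closest_point (cball (0::real^'n) 1))"
    by (intro continuous_on_closest_point) auto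
  then have "continuous_on UNIV (direction :: real^'n \<Rightarrow> _)"
    unfolding direction_def[abs_def] by (intro continuous_intros)
  then show "continuous_on S f \<Longrightarrow> continuous_on S (\<lambda>x. direction (f x))"
    by (rule continuous_on_compose2) auto
qed

lemma inner_mat_1_mat_1: "(mat 1 :: real^2^2) \<bullet> mat 1 = 2"
  by (simp add: inner_vec_def mat_def sum_2)

lemma inner_outer_mat_1: "outer x x \<bullet> (mat 1 :: real^2^2) = x \<bullet> x"
  by (simp add: inner_vec_def mat_def outer_def sum_2)

text \<open>\<open>outer n n\<close> has inner product 1 with the identity and with itself, hence 0
  with the Jacobian, so \<open>k\<close> drops out. In dimension two the identity has squared norm
  2, so \<open>mat 1 - outer n n\<close> has norm 1 and the stretched square is
  \<open>(1 / r)^2 \<ge> 1\<close>, where \<open>powr_ext\<close> is the true power.\<close>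

lemma vfield_at_radial:
  fixes n :: "real^2"
  assumes n: "norm n = 1" and r: "0 < r" "r \<le> 1"
  shows "vfield p c k (outer n n) ((1 / r) *\<^sub>R (mat 1 - outer n n))
    = r powr (1 - p) *\<^sub>R (mat 1 + (c - 1) *\<^sub>R outer n n)"
proof -
  let ?z = "(1 / r) *\<^sub>R (mat 1 - outer n n)"
  have nn: "n \<bullet> n = 1" using n by (simp add: norm_eq_1)
  have "outer n n \<bullet> ?z = 0"
    by (simp add: inner_diff_right inner_outer inner_outer_mat_1 nn)
  moreover have "?z \<bullet> ?z = (1 / r)\<^sup>2"
    by (simp add: inner_diff_right inner_diff_left inner_outer inner_outer_mat_1 inner_mat_1_mat_1 nn
        inner_commute[of "mat 1" "outer n n"] power2_eq_square)
  ultimately have q: "stretch_sq k (outer n n) ?z = (1 / r)\<^sup>2" and s: "stretch k (outer n n) ?z = ?z"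
    by (simp_all add: stretch_sq_def stretch_def)
  have "1 \<le> (1 / r)\<^sup>2" using r by (intro one_le_power) simp
  then have P: "powr_ext (a / 2) ((1 / r)\<^sup>2) = r powr (- a)" for a
    using r by (simp add: powr_ext_eq_powr power2_powr_half powr_divide powr_minus_divide)
  have "r powr (2 - p) * (1 / r) = r powr (1 - p)"
    using r powr_diff[of r "2 - p" 1] by simp
  then have *: "powr_ext ((p - 2) / 2) ((1 / r)\<^sup>2) *\<^sub>R ?z = r powr (1 - p) *\<^sub>R (mat 1 - outer n n)"
    unfolding P by simp
  have "powr_ext ((p - 1) / 2) ((1 / r)\<^sup>2) = r powr (1 - p)"
    unfolding P by simp
  then show ?thesis
    unfolding vfield_def q s * by (simp add: algebra_simps)
qed

lemma has_derivative_norm_powr: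
  fixes x :: "'a::real_inner"
  assumes "x \<noteq> 0"
  shows "((\<lambda>x. norm x powr a) has_derivative (\<lambda>w. a * norm x powr (a - 2) * (x \<bullet> w))) (at x)"
proof -
  have "((\<lambda>t. t powr a) has_real_derivative a * norm x powr (a - 1)) (at (norm x))"
    using assms has_real_derivative_powr[of "norm x" a] by simp
  from DERIV_compose_FDERIV[OF this has_derivative_norm[OF assms]]
  have "((\<lambda>x. norm x powr a) has_derivative (\<lambda>w. (w \<bullet> sgn x) * (a * norm x powr (a - 1)))) (at x)"
    by simp
  also have "(\<lambda>w. (w \<bullet> sgn x) * (a * norm x powr (a - 1))) = (\<lambda>w. a * norm x powr (a - 2) * (x \<bullet> w))"
  proof -
    have "norm x powr (a - 1) / norm x = norm x powr (a - 2)"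
      using assms powr_diff[of "norm x" "a - 1" 1] by simp
    then show ?thesis
      by (auto simp: sgn_div_norm inner_commute fun_eq_iff divide_inverse mult_ac)
  qed
  finally show ?thesis .
qed

lemma continuous_on_norm_powr:
  fixes f :: "'a::topological_space \<Rightarrow> 'b::real_normed_vector"
  assumes "continuous_on S f" "\<And>x. x \<in> S \<Longrightarrow> f x \<noteq> 0"
  shows "continuous_on S (\<lambda>x. norm (f x) powr a)"
  using assms by (intro continuous_intros) auto

section \<open>The explicit weak Jacobian and flux\<close>

text \<open>Entry \<open>i\<close>, \<open>j\<close> is the \<open>j\<close>-th partial derivative
  of the \<open>i\<close>-th component; \<open>axis j 1 $ i\<close> is the Kronecker delta.
  Unnormalised coordinates with powers of the norm make it easy to differentiate and give the value
  0 at the origin.\<close>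

definition radial_jac :: "real^2 \<Rightarrow> real^2^2" where
  "radial_jac x = (\<chi> i j. norm x powr (- 1) * axis j 1 $ i - norm x powr (- 3) * x $ j * x $ i)"

definition flux :: "real \<Rightarrow> real \<Rightarrow> real^2 \<Rightarrow> real^2^2" where
  "flux p c x = (\<chi> i j. norm x powr (1 - p) * axis j 1 $ i + (c - 1) * (norm x powr (- 1 - p) * (x $ j * x $ i)))"

lemma norm_powr_mult_square: "norm x powr (a - 2) * (norm x)\<^sup>2 = norm x powr a"
  if "x \<noteq> 0" for x :: "'a::real_normed_vector"
  using that powr_add[of "norm x" "a - 2" 2] by (simp add: powr_numeral)

lemma radial_jac_eq:
  assumes "x \<noteq> 0"
  defines "n \<equiv> x /\<^sub>R norm x"
  shows "radial_jac x = (1 / norm x) *\<^sub>R (mat 1 - outer n n)"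
proof -
  have "norm x powr (- 3) = 1 / norm x * (inverse (norm x) * inverse (norm x))"
    using assms(1) by (simp add: powr_minus powr_numeral power3_eq_cube divide_inverse)
  then show ?thesis
    using assms(1)
    by (auto simp: radial_jac_def outer_def mat_def vec_eq_iff axis_def n_def powr_minus divide_inverse algebra_simps)
qed

lemma flux_eq:
  assumes "x \<noteq> 0"
  defines "n \<equiv> x /\<^sub>R norm x"
  shows "flux p c x = norm x powr (1 - p) *\<^sub>R (mat 1 + (c - 1) *\<^sub>R outer n n)"
proof -
  have "norm x powr (- 1 - p) = norm x powr (1 - p) * (inverse (norm x) * inverse (norm x))"
    using assms(1) norm_powr_mult_square[of x "1 - p"] by (simp add: field_simps power2_eq_square)
  then show ?thesis
    by (auto simp: flux_def outer_def mat_def vec_eq_iff axis_def n_def algebra_simps)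
qed

lemma vfield_radial_jac:
  assumes "x \<noteq> 0" "norm x < 1"
  shows "vfield p c k (direction (x /\<^sub>R norm x)) (radial_jac x) = flux p c x"
proof -
  have "norm (x /\<^sub>R norm x) = 1" using assms by simp
  then show ?thesis
    using assms vfield_at_radial[of "x /\<^sub>R norm x" "norm x" p c k]
    by (simp add: direction_unit radial_jac_eq flux_eq)
qed

lemma norm_radial_jac: "norm (radial_jac x) = norm x powr (- 1)"
proof (cases "x = 0")
  case True
  have "radial_jac 0 = 0" by (simp add: radial_jac_def vec_eq_iff)
  then show ?thesis using True by simp
next
  case False
  let ?n = "x /\<^sub>R norm x"
  have "norm ?n = 1" using False by simp
  then have nn: "?n \<bullet> ?n = 1" by (simp only: norm_eq_1)
  have "(mat 1 - outer ?n ?n) \<bullet> (mat 1 - outer ?n ?n) = 1"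
    unfolding inner_diff_right inner_diff_left inner_commute[of "mat 1" "outer ?n ?n"]
      inner_outer inner_outer_mat_1 inner_mat_1_mat_1 nn by simp
  then have "norm (mat 1 - outer ?n ?n) = 1" by (simp add: norm_eq_1)
  then show ?thesis
    using False by (simp add: radial_jac_eq powr_minus divide_inverse)
qed

lemma continuous_on_radial_jac: "continuous_on (- {0}) radial_jac"
  unfolding radial_jac_def[abs_def] by (intro continuous_intros continuous_on_norm_powr) auto

lemma test_funD:
  assumes "test_fun U \<phi>"
  shows "compact (closure (support_on UNIV \<phi>))" "closure (support_on UNIV \<phi>) \<subseteq> U"
    "x \<notin> closure (support_on UNIV \<phi>) \<Longrightarrow> \<phi> x = 0"
    "(\<phi> has_derivative frechet_derivative \<phi> (at x)) (at x)"
    "continuous_on UNIV (\<lambda>x. frechet_derivative \<phi> (at x) v)"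
proof -
  have Ck: "Ck_on (Suc 0) UNIV \<phi>"
    using assms by (auto simp only: test_fun_def smooth_on_def)
  show "(\<phi> has_derivative frechet_derivative \<phi> (at x)) (at x)"
    by (rule Ck_on_has_derivative[OF Ck])
  show "continuous_on UNIV (\<lambda>x. frechet_derivative \<phi> (at x) v)"
    using Ck by simp
  show "x \<notin> closure (support_on UNIV \<phi>) \<Longrightarrow> \<phi> x = 0"
    using closure_subset[of "support_on UNIV \<phi>"] by (auto simp: support_on_def)
qed (use assms in \<open>auto simp: test_fun_def\<close>)

text \<open>Integration by parts with \<open>q = 1\<close>: the components of the map are bounded,
  which is order \<open>norm x powr 0\<close>, and their derivatives have order
  \<open>norm x powr (- 1)\<close>, integrable in the plane.\<close>

lemma weak_jacobian_radial: "weak_jacobian (ball 0 1) (\<lambda>x::real^2. x /\<^sub>R norm x) radial_jac"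
  unfolding weak_jacobian_def
proof (intro allI impI)
  fix \<phi> :: "real^2 \<Rightarrow> real" and i j :: 2
  assume "test_fun (ball 0 1) \<phi>"
  note K = test_funD[OF this]
  define g where "g x = norm x powr (- 1) * x $ i" for x :: "real^2"
  define g' where "g' x w = norm x powr (- 1) * w $ i - norm x powr (- 3) * (x \<bullet> w) * x $ i" for x w :: "real^2"
  have jac: "radial_jac x $ i $ j = g' x (axis j 1)" for x
    by (simp add: radial_jac_def g'_def inner_axis)
  have "(LINT x:ball 0 1|lborel. g x * frechet_derivative \<phi> (at x) (axis j 1))
      = - (LINT x:ball 0 1|lborel. g' x (axis j 1) * \<phi> x)"
  proof (rule integration_by_parts_ball_punctured(3)[where q = 1 and C = 2, OF _ _ _ _ _ _ K(4,5,1-3)])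
    show "(g has_derivative g' x) (at x)" if "x \<noteq> 0" for x
      unfolding g_def[abs_def] g'_def[abs_def]
      by (rule has_derivative_eq_rhs[OF has_derivative_mult[OF has_derivative_norm_powr[OF that]
            bounded_linear_imp_has_derivative[OF bounded_linear_vec_nth]]])
        (simp add: fun_eq_iff algebra_simps)
    show "continuous_on (- {0}) (\<lambda>x. g' x (axis j 1))"
      unfolding g'_def by (intro continuous_intros continuous_on_norm_powr) auto
    show "\<bar>g x\<bar> \<le> 2 * norm x powr (1 - 1)" if "x \<noteq> 0" for x
      using that component_le_norm_cart[of x i] by (simp add: g_def abs_mult powr_minus field_simps)
    show "\<bar>g' x (axis j 1)\<bar> \<le> 2 * norm x powr - 1" if "x \<noteq> 0" for x
      using component_le_norm_cart[of "radial_jac x $ i" j] norm_radial_jac[of x] Finite_Cartesian_Product.norm_nth_le[of "radial_jac x" i]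
      by (simp add: jac)
  qed auto
  moreover have "(x /\<^sub>R norm x) $ i = g x" for x
    by (simp add: g_def powr_minus)
  ultimately show "(LINT x:ball 0 1|lborel. (x /\<^sub>R norm x) $ i * frechet_derivative \<phi> (at x) (axis j 1))
      = - (LINT x:ball 0 1|lborel. radial_jac x $ i $ j * \<phi> x)"
    by (simp add: jac)
qed

section \<open>Uniqueness of the weak Jacobian and integrability on the disc\<close>

lemma test_fun_bounded_borel:
  fixes \<phi> :: "'a::euclidean_space \<Rightarrow> real"
  assumes "test_fun U \<phi>"
  obtains M where "M \<ge> 0" "\<And>x. \<bar>\<phi> x\<bar> \<le> M" "\<phi> \<in> borel_measurable borel"
proof -
  have cont: "continuous_on UNIV \<phi>"
    using test_funD(4)[OF assms] by (intro has_derivative_imp_continuous_on) auto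
  show thesis
    by (rule bounded_continuous_support[OF cont test_funD(1)[OF assms] test_funD(3)[OF assms]], assumption)
      (use that cont in \<open>auto intro: borel_measurable_continuous_onI\<close>)
qed

lemma set_integrable_mult_test_fun:
  fixes f \<phi> :: "'a::euclidean_space \<Rightarrow> real"
  assumes f: "set_integrable lborel A f" and "test_fun U \<phi>"
  shows "set_integrable lborel A (\<lambda>x. f x * \<phi> x)"
proof -
  obtain M where M: "M \<ge> 0" "\<And>x. \<bar>\<phi> x\<bar> \<le> M" and [measurable]: "\<phi> \<in> borel_measurable borel"
    using test_fun_bounded_borel[OF assms(2)] by metis
  let ?F = "\<lambda>x. indicator A x * f x"
  have F: "integrable lborel ?F" using f by (simp add: set_integrable_def)
  have [measurable]: "?F \<in> borel_measurable borel"
    using borel_measurable_integrable[OF F] by simp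
  have "integrable lborel (\<lambda>x. ?F x * \<phi> x)"
  proof (rule Bochner_Integration.integrable_bound)
    show "integrable lborel (\<lambda>x. ?F x * M)" using F by simp
    show "AE x in lborel. norm (?F x * \<phi> x) \<le> norm (?F x * M)"
      using M by (intro AE_I2) (simp add: abs_mult mult_left_mono)
  qed measurable
  then show ?thesis by (simp add: set_integrable_def mult.assoc)
qed

text \<open>Both candidates have the same integrals against every test function, so the fundamental
  lemma applies to each entry of the difference. Integrability justifies subtracting under the
  integral sign.\<close>

lemma weak_jacobian_unique:
  fixes u :: "real^'n \<Rightarrow> real^'m"
  assumes "weak_jacobian (ball 0 1) u G" "weak_jacobian (ball 0 1) u H"
    and "set_integrable lborel (ball 0 1) G" "set_integrable lborel (ball 0 1) H"
  shows "AE x in lborel. x \<in> ball 0 1 \<longrightarrow> G x = H x"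
proof -
  have comp: "set_integrable lborel (ball 0 1) (\<lambda>x. F x $ i $ j)"
    if "set_integrable lborel (ball 0 1) F" for F :: "real^'n \<Rightarrow> real^'n^'m" and i j
    using integrable_bounded_linear[OF bounded_linear_compose[OF bounded_linear_vec_nth[of j] bounded_linear_vec_nth[of i]]
        that[unfolded set_integrable_def]]
    by (simp add: set_integrable_def)
  have "AE x in lborel. x \<in> ball 0 1 \<longrightarrow> G x $ i $ j - H x $ i $ j = 0" for i j
  proof (rule fundamental_lemma_ball)
    show "set_integrable lborel (ball 0 1) (\<lambda>x. G x $ i $ j - H x $ i $ j)"
      by (intro set_integral_diff comp assms)
    fix \<phi> :: "real^'n \<Rightarrow> real" assume \<phi>: "test_fun (ball 0 1) \<phi>"
    have "(LINT x:ball 0 1|lborel. G x $ i $ j * \<phi> x) = (LINT x:ball 0 1|lborel. H x $ i $ j * \<phi> x)"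
      using assms(1)[unfolded weak_jacobian_def, rule_format, OF \<phi>, of i j]
        assms(2)[unfolded weak_jacobian_def, rule_format, OF \<phi>, of i j] by linarith
    then show "(LINT x:ball 0 1|lborel. (G x $ i $ j - H x $ i $ j) * \<phi> x) = 0"
      using set_integrable_mult_test_fun[OF comp[OF assms(3)] \<phi>] set_integrable_mult_test_fun[OF comp[OF assms(4)] \<phi>]
      by (simp add: left_diff_distrib set_integral_diff)
  qed
  then have "AE x in lborel. \<forall>i j. x \<in> ball 0 1 \<longrightarrow> G x $ i $ j - H x $ i $ j = 0"
    by (intro eventually_all_finite)
  then show ?thesis
    by eventually_elim (simp add: vec_eq_iff)
qed

lemma set_integrable_bounded:
  fixes f :: "'a::euclidean_space \<Rightarrow> real"
  assumes "set_borel_measurable lborel A f" "bounded A" "A \<in> sets borel" "\<And>x. x \<in> A \<Longrightarrow> \<bar>f x\<bar> \<le> M"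
  shows "set_integrable lborel A f"
  unfolding set_integrable_def
proof (rule Bochner_Integration.integrable_bound)
  show "integrable lborel (\<lambda>x. indicator A x * M)"
    using emeasure_bounded_finite[OF assms(2)] assms(3) by (intro integrable_mult_left integrable_real_indicator) auto
  show "AE x in lborel. norm (indicator A x *\<^sub>R f x) \<le> norm (indicator A x * M)"
    using assms(4) by (intro AE_I2) (fastforce simp: indicator_def)
qed (use assms in \<open>simp add: set_borel_measurable_def\<close>)

text \<open>On a set of finite measure, \<open>t \<le> 1 + t powr p\<close> gives an integrable
  majorant.\<close>

lemma Lp_on_imp_set_integrable:
  fixes f :: "'a::euclidean_space \<Rightarrow> 'b::euclidean_space"
  assumes "Lp_on p A f" "1 \<le> p" "bounded A" "A \<in> sets borel"
  shows "set_integrable lborel A f"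
  unfolding set_integrable_def
proof (rule Bochner_Integration.integrable_bound)
  have "set_integrable lborel A (\<lambda>x. 1 :: real)"
    using assms by (intro set_integrable_bounded[of _ _ 1]) (auto simp: set_borel_measurable_def)
  then have "set_integrable lborel A (\<lambda>x. 1 + norm (f x) powr p)"
    using assms by (intro set_integral_add) (auto simp: Lp_on_def)
  then show "integrable lborel (\<lambda>x. indicator A x *\<^sub>R (1 + norm (f x) powr p))"
    by (simp add: set_integrable_def)
  have "norm (f x) \<le> 1 + norm (f x) powr p" for x
  proof (cases "norm (f x) \<le> 1")
    case False
    then have "norm (f x) powr 1 \<le> norm (f x) powr p"
      using assms by (intro powr_mono) auto
    then show ?thesis using False by simp
  qed (simp add: add_increasing2)
  then show "AE x in lborel. norm (indicator A x *\<^sub>R f x) \<le> norm (indicator A x *\<^sub>R (1 + norm (f x) powr p))"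
    by (intro AE_I2) (auto simp: indicator_def)
qed (use assms in \<open>simp add: Lp_on_def set_borel_measurable_def\<close>)

lemma set_borel_measurable_punctured:
  fixes f :: "'a::euclidean_space \<Rightarrow> 'b::euclidean_space"
  assumes "continuous_on (- {0}) f" "A \<in> sets borel"
  shows "set_borel_measurable lborel A f"
proof -
  have [measurable]: "f \<in> borel_measurable borel"
    using assms(1) by (intro borel_measurable_continuous_countable_exceptions[of "{0}"]) auto
  show ?thesis
    using assms(2) unfolding set_borel_measurable_def by measurable
qed

lemma Lp_on_radial_jac:
  assumes "1 < p" "p < 2"
  shows "Lp_on p (ball 0 1) radial_jac"
proof -
  have "norm (radial_jac x) powr p = norm x powr (- p)" for x
    unfolding norm_radial_jac powr_powr by simp
  then show ?thesis
    using assms set_integrable_norm_powr_ball[where 'a = "real^2", of p]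
    by (simp add: Lp_on_def set_borel_measurable_punctured continuous_on_radial_jac)
qed

section \<open>The flux has weak divergence zero, also across the origin\<close>

lemma continuous_on_radial: "continuous_on (- {0}) (\<lambda>x::'a::real_normed_vector. x /\<^sub>R norm x)"
  by (intro continuous_intros) auto

text \<open>One row \<open>i\<close> of the flux against a scalar test function. The entries have
  order \<open>norm x powr (1 - p)\<close> and their derivatives order
  \<open>norm x powr (- p)\<close>, so integration by parts applies with \<open>q = p\<close>; it is
  here that \<open>p < 2\<close>, the dimension, removes the singularity.\<close>

lemma flux_divergence_free:
  fixes \<phi> :: "real^2 \<Rightarrow> real"
  assumes p: "1 < p" "p < 2" and c: "c = 1 / (2 - p)"
    and tf: "test_fun (ball 0 1) \<phi>"
  shows "\<And>j. set_integrable lborel (ball 0 1) (\<lambda>x. flux p c x $ i $ j * frechet_derivative \<phi> (at x) (axis j 1))"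
    and "(\<Sum>j\<in>UNIV. LINT x:ball 0 1|lborel. flux p c x $ i $ j * frechet_derivative \<phi> (at x) (axis j 1)) = 0"
proof -
  have c1: "c \<ge> 1" using p unfolding c by simp
  define D where "D j x w = (1 - p) * norm x powr (- 1 - p) * (x \<bullet> w) * axis j 1 $ i
      + (c - 1) * (norm x powr (- 1 - p) * (x $ j * w $ i + w $ j * x $ i)
        + (- 1 - p) * norm x powr (- 3 - p) * (x \<bullet> w) * (x $ j * x $ i))" for j :: 2 and x w :: "real^2"
  have \<delta>: "\<bar>axis j (1::real) $ i\<bar> \<le> 1" for j :: 2 by (simp add: axis_def)
  have r1: "norm x powr (- 1 - p) * norm x = norm x powr (- p)" if "x \<noteq> 0" for x :: "real^2"
    using that powr_add[of "norm x" "- 1 - p" 1] by simp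
  have r2: "norm x powr (- 1 - p) * (norm x * norm x) = norm x powr (1 - p)" if "x \<noteq> 0" for x :: "real^2"
    using norm_powr_mult_square[OF that, of "1 - p"] by (simp add: power2_eq_square)
  have r3: "norm x powr (- 3 - p) * (norm x * norm x) = norm x powr (- 1 - p)" if "x \<noteq> 0" for x :: "real^2"
    using norm_powr_mult_square[OF that, of "- 1 - p"] by (simp add: power2_eq_square)
  have comp: "\<bar>x $ k\<bar> \<le> norm x" for x :: "real^2" and k
    by (rule component_le_norm_cart)
  have flux: "((\<lambda>x. flux p c x $ i $ j) has_derivative D j x) (at x)" if "x \<noteq> 0" for x j
  proof -
    have e: "1 - p - 2 = - 1 - p" "- 1 - p - 2 = - 3 - p" by simp_all
    have nth: "((\<lambda>x. x $ k) has_derivative (\<lambda>w. w $ k)) (at x)" for k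
      by (rule bounded_linear_imp_has_derivative[OF bounded_linear_vec_nth])
    note A = has_derivative_norm_powr[OF that, of "1 - p", unfolded e]
    note B = has_derivative_norm_powr[OF that, of "- 1 - p", unfolded e]
    show ?thesis
      unfolding flux_def vec_lambda_beta
      by (rule has_derivative_eq_rhs[OF has_derivative_add[OF has_derivative_mult_left[OF A]
            has_derivative_mult_right[OF has_derivative_mult[OF B has_derivative_mult[OF nth nth]]]]])
        (simp add: D_def fun_eq_iff algebra_simps)
  qed
  have D_eq: "D j x (axis j 1) = (1 - p) * norm x powr (- 1 - p) * x $ j * axis j 1 $ i
      + (c - 1) * (norm x powr (- 1 - p) * (x $ j * axis j 1 $ i + x $ i)
        + (- 1 - p) * norm x powr (- 3 - p) * x $ j * (x $ j * x $ i))" for x j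
    by (simp add: D_def inner_axis)
  have D_cont: "continuous_on (- {0}) (\<lambda>x. D j x (axis j 1))" for j
    unfolding D_def by (intro continuous_intros continuous_on_norm_powr) auto
  have flux_bound: "\<bar>flux p c x $ i $ j\<bar> \<le> (5 * c) * norm x powr (1 - p)" if "x \<noteq> 0" for x j
  proof -
    have "\<bar>norm x powr (1 - p) * axis j 1 $ i\<bar> \<le> norm x powr (1 - p)"
      using \<delta>[of j] by (simp add: abs_mult mult_left_le)
    moreover have "\<bar>norm x powr (- 1 - p) * (x $ j * x $ i)\<bar> \<le> norm x powr (- 1 - p) * (norm x * norm x)"
      unfolding abs_mult using comp by (intro mult_mono) auto
    then have "\<bar>(c - 1) * (norm x powr (- 1 - p) * (x $ j * x $ i))\<bar> \<le> (c - 1) * norm x powr (1 - p)"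
      unfolding r2[OF that] abs_mult[of "c - 1"] using c1 by (intro mult_mono) auto
    ultimately have "\<bar>flux p c x $ i $ j\<bar> \<le> norm x powr (1 - p) + (c - 1) * norm x powr (1 - p)"
      unfolding flux_def by simp
    also have "\<dots> \<le> (5 * c) * norm x powr (1 - p)"
      using c1 by (simp add: algebra_simps)
    finally show ?thesis .
  qed
  have D_bound: "\<bar>D j x (axis j 1)\<bar> \<le> (5 * c) * norm x powr (- p)" if "x \<noteq> 0" for x j
  proof -
    let ?R = "norm x powr (- p)"
    have R1: "\<bar>norm x powr (- 1 - p) * x $ k\<bar> \<le> ?R" for k
      unfolding r1[OF that, symmetric] abs_mult using comp by (intro mult_mono) auto
    have a: "\<bar>(1 - p) * norm x powr (- 1 - p) * x $ j * axis j 1 $ i\<bar> \<le> ?R"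
    proof -
      have "\<bar>1 - p\<bar> * (\<bar>norm x powr (- 1 - p) * x $ j\<bar> * \<bar>axis j 1 $ i\<bar>) \<le> 1 * (?R * 1)"
        using p by (intro mult_mono R1 \<delta>) auto
      then show ?thesis by (simp add: abs_mult mult.assoc)
    qed
    have b: "\<bar>norm x powr (- 1 - p) * (x $ j * axis j 1 $ i + x $ i)\<bar> \<le> 2 * ?R"
    proof -
      have "\<bar>norm x powr (- 1 - p) * x $ j\<bar> * \<bar>axis j 1 $ i\<bar> \<le> ?R * 1"
        by (intro mult_mono R1 \<delta>) auto
      then have "\<bar>norm x powr (- 1 - p) * x $ j * axis j 1 $ i\<bar> \<le> ?R"
        by (simp add: abs_mult)
      then show ?thesis using R1[of i] by (simp add: distrib_left mult.assoc)
    qed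
    have d: "\<bar>(- 1 - p) * norm x powr (- 3 - p) * x $ j * (x $ j * x $ i)\<bar> \<le> 3 * ?R"
    proof -
      have "\<bar>- 1 - p\<bar> * (norm x powr (- 3 - p) * (\<bar>x $ j\<bar> * \<bar>x $ j\<bar>) * \<bar>x $ i\<bar>)
          \<le> 3 * (norm x powr (- 3 - p) * (norm x * norm x) * norm x)"
        using p comp by (intro mult_mono) auto
      also have "\<dots> = 3 * ?R"
        unfolding r3[OF that] r1[OF that] ..
      finally show ?thesis
        by (simp only: abs_mult abs_of_nonneg[OF powr_ge_zero] mult_ac)
    qed
    \<comment> \<open>The 2 counts the two terms of the product rule for
      \<open>x $ j * x $ i\<close>, the 3 bounds \<open>1 + p\<close>; together
      \<open>1 + 5 * (c - 1) \<le> 5 * c\<close>.\<close>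
    have "\<bar>D j x (axis j 1)\<bar> \<le> ?R + (c - 1) * (2 * ?R + 3 * ?R)"
    proof -
      have "\<bar>norm x powr (- 1 - p) * (x $ j * axis j 1 $ i + x $ i)
          + (- 1 - p) * norm x powr (- 3 - p) * x $ j * (x $ j * x $ i)\<bar> \<le> 2 * ?R + 3 * ?R"
        using b d by linarith
      then have "\<bar>(c - 1) * (norm x powr (- 1 - p) * (x $ j * axis j 1 $ i + x $ i)
          + (- 1 - p) * norm x powr (- 3 - p) * x $ j * (x $ j * x $ i))\<bar> \<le> (c - 1) * (2 * ?R + 3 * ?R)"
        unfolding abs_mult[of "c - 1"] using c1 by (intro mult_mono) auto
      then show ?thesis unfolding D_eq using a by linarith
    qed
    also have "\<dots> \<le> (5 * c) * ?R" using c1 by (simp add: algebra_simps)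
    finally show ?thesis .
  qed
  have div0: "(\<Sum>j\<in>UNIV. D j x (axis j 1)) = 0" for x
  proof (cases "x = 0")
    case False
    have "norm x * norm x = x $ 1 * x $ 1 + x $ 2 * x $ 2"
      using dot_square_norm[of x] by (simp add: inner_vec_def sum_2 power2_eq_square)
    then have R3: "norm x powr (- 1 - p) = norm x powr (- 3 - p) * (x $ 1 * x $ 1 + x $ 2 * x $ 2)"
      using r3[OF False] by simp
    \<comment> \<open>The 3 is dimension plus one: summing
      \<open>x $ j * axis j 1 $ i + x $ i\<close> over \<open>j\<close> gives
      \<open>x $ i + 2 * x $ i\<close>.\<close>
    have "(\<Sum>j\<in>UNIV. D j x (axis j 1))
      = norm x powr (- 1 - p) * x $ i * (1 - p + 3 * (c - 1))
        - (c - 1) * (1 + p) * x $ i * (norm x powr (- 3 - p) * (x $ 1 * x $ 1 + x $ 2 * x $ 2))"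
      unfolding sum_2 D_eq using exhaust_2[of i] by (auto simp: axis_def algebra_simps)
    also have "\<dots> = norm x powr (- 1 - p) * x $ i * (1 - p + (c - 1) * (2 - p))"
      unfolding R3[symmetric] by (simp add: algebra_simps)
    \<comment> \<open>This equation determines \<open>c = 1 / (2 - p)\<close>.\<close>
    also have "1 - p + (c - 1) * (2 - p) = 0"
      using p unfolding c by (simp add: left_diff_distrib)
    finally show ?thesis by simp
  qed (simp add: D_def)
  have q: "0 \<le> p" "p < DIM(real^2)" using p by simp_all
  note ibp = integration_by_parts_ball_punctured[where g = "\<lambda>x. flux p c x $ i $ j" and g' = "D j"
      and v = "axis j 1" and q = p and C = "5 * c" and \<phi> = \<phi> and \<phi>' = "\<lambda>x. frechet_derivative \<phi> (at x)" for j,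
      OF q flux D_cont flux_bound D_bound test_funD(4,5,1-3)[OF tf]]
  show "set_integrable lborel (ball 0 1) (\<lambda>x. flux p c x $ i $ j * frechet_derivative \<phi> (at x) (axis j 1))" for j
    by (rule ibp(1))
  have i2: "set_integrable lborel (ball 0 1) (\<lambda>x. D j x (axis j 1) * \<phi> x)" for j
    by (rule ibp(2))
  have "(\<Sum>j\<in>UNIV. LINT x:ball 0 1|lborel. flux p c x $ i $ j * frechet_derivative \<phi> (at x) (axis j 1))
      = (\<Sum>j\<in>UNIV. - (LINT x:ball 0 1|lborel. D j x (axis j 1) * \<phi> x))"
    by (intro sum.cong refl ibp(3))
  also have "\<dots> = - (LINT x:ball 0 1|lborel. D 1 x (axis 1 1) * \<phi> x + D 2 x (axis 2 1) * \<phi> x)"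
    by (simp add: sum_2 set_integral_add(2)[OF i2 i2])
  also have "\<dots> = 0"
    using div0 by (simp add: sum_2 flip: distrib_right)
  finally show "(\<Sum>j\<in>UNIV. LINT x:ball 0 1|lborel. flux p c x $ i $ j * frechet_derivative \<phi> (at x) (axis j 1)) = 0" .
qed

lemma Ck_on_bounded_linear_compose:
  assumes "bounded_linear h"
  shows "Ck_on n UNIV f \<Longrightarrow> Ck_on n UNIV (\<lambda>x. h (f x))"
proof (induction n arbitrary: f)
  case 0
  then show ?case by (simp add: bounded_linear.continuous_on[OF assms])
next
  case (Suc n)
  show ?case
    by (rule Ck_on_SucI[OF bounded_linear.has_derivative[OF assms Ck_on_has_derivative[OF Suc.prems]]])
      (use Suc in auto)
qed

lemma test_fun_component:
  fixes \<phi> :: "'a::euclidean_space \<Rightarrow> real^'m"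
  assumes "test_fun U \<phi>"
  shows "test_fun U (\<lambda>x. \<phi> x $ i)"
    and "frechet_derivative (\<lambda>x. \<phi> x $ i) (at x) v = frechet_derivative \<phi> (at x) v $ i"
proof -
  show "test_fun U (\<lambda>x. \<phi> x $ i)"
  proof (rule test_funI[OF _ test_funD(1,2)[OF assms]])
    show "Ck_on n UNIV (\<lambda>x. \<phi> x $ i)" for n
      using assms by (intro Ck_on_bounded_linear_compose[OF bounded_linear_vec_nth])
        (simp add: test_fun_def smooth_on_def)
    show "\<phi> x $ i = 0" if "x \<notin> closure (support_on UNIV \<phi>)" for x
      using test_funD(3)[OF assms that] by simp
  qed
  have "((\<lambda>x. \<phi> x $ i) has_derivative (\<lambda>v. frechet_derivative \<phi> (at x) v $ i)) (at x)"
    by (rule bounded_linear.has_derivative[OF bounded_linear_vec_nth test_funD(4)[OF assms]])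
  from frechet_derivative_at[OF this]
  show "frechet_derivative (\<lambda>x. \<phi> x $ i) (at x) v = frechet_derivative \<phi> (at x) v $ i"
    by (simp add: fun_eq_iff)
qed

text \<open>The inner product of matrices is the sum over rows, and row \<open>i\<close> is tested
  with component \<open>i\<close> of \<open>\<phi>\<close>.\<close>

lemma flux_weakly_divergence_free:
  fixes \<phi> :: "real^2 \<Rightarrow> real^2"
  assumes p: "1 < p" "p < 2" and c: "c = 1 / (2 - p)" and tf: "test_fun (ball 0 1) \<phi>"
  shows "set_integrable lborel (ball 0 1) (\<lambda>x. flux p c x \<bullet> matrix (frechet_derivative \<phi> (at x)))"
    and "(LINT x:ball 0 1|lborel. flux p c x \<bullet> matrix (frechet_derivative \<phi> (at x))) = 0"
proof -
  let ?t = "\<lambda>i j x. flux p c x $ i $ j * frechet_derivative (\<lambda>x. \<phi> x $ i) (at x) (axis j 1)"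
  have expand: "flux p c x \<bullet> matrix (frechet_derivative \<phi> (at x)) = (?t 1 1 x + ?t 1 2 x) + (?t 2 1 x + ?t 2 2 x)" for x
    by (simp add: inner_vec_def sum_2 matrix_def test_fun_component(2)[OF tf])
  note i = flux_divergence_free(1)[OF p c test_fun_component(1)[OF tf]]
  note z = flux_divergence_free(2)[OF p c test_fun_component(1)[OF tf], unfolded sum_2]
  show "set_integrable lborel (ball 0 1) (\<lambda>x. flux p c x \<bullet> matrix (frechet_derivative \<phi> (at x)))"
    unfolding expand by (intro set_integral_add(1) i)
  have "(LINT x:ball 0 1|lborel. flux p c x \<bullet> matrix (frechet_derivative \<phi> (at x)))
      = ((LINT x:ball 0 1|lborel. ?t 1 1 x) + (LINT x:ball 0 1|lborel. ?t 1 2 x))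
        + ((LINT x:ball 0 1|lborel. ?t 2 1 x) + (LINT x:ball 0 1|lborel. ?t 2 2 x))"
    unfolding expand
    by (subst set_integral_add(2); (intro set_integral_add(1) i)?)+ (rule refl)
  then show "(LINT x:ball 0 1|lborel. flux p c x \<bullet> matrix (frechet_derivative \<phi> (at x))) = 0"
    unfolding z by simp
qed

lemma borel_measurable_vfield_direction:
  fixes u :: "'a \<Rightarrow> real^'n" and G :: "'a \<Rightarrow> real^'n^'n"
  assumes "u \<in> borel_measurable M" "G \<in> borel_measurable M"
  shows "(\<lambda>x. vfield p c k (direction (u x)) (G x)) \<in> borel_measurable M"
  by (rule borel_measurable_continuous_Pair[OF assms])
    (intro continuous_intros)

text \<open>By uniqueness, \<open>G\<close> equals \<open>radial_jac\<close> almost everywhere on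
  the disc, where the field becomes the flux; both claims then transfer from the flux. What remains
  is measurability, since \<open>G\<close> is only known to be measurable after multiplication with
  the indicator of the disc.\<close>

lemma vfield_weak_solution:
  fixes G :: "real^2 \<Rightarrow> real^2^2" and \<phi> :: "real^2 \<Rightarrow> real^2" and k :: real
  assumes p: "1 < p" "p < 2" and c: "c = 1 / (2 - p)"
    and G: "weak_jacobian (ball 0 1) (\<lambda>x. x /\<^sub>R norm x) G" "Lp_on p (ball 0 1) G"
    and tf: "test_fun (ball 0 1) \<phi>"
  defines "F \<equiv> \<lambda>x. vfield p c k (direction (x /\<^sub>R norm x)) (G x) \<bullet> matrix (frechet_derivative \<phi> (at x))"
  shows "set_integrable lborel (ball 0 1) F" "(LINT x:ball 0 1|lborel. F x) = 0"
proof -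
  let ?S = "\<lambda>x. flux p c x \<bullet> matrix (frechet_derivative \<phi> (at x))"
  have AE_G: "AE x in lborel. x \<in> ball 0 1 \<longrightarrow> G x = radial_jac x"
    using p by (intro weak_jacobian_unique[OF G(1) weak_jacobian_radial]
        Lp_on_imp_set_integrable[OF G(2)] Lp_on_imp_set_integrable[OF Lp_on_radial_jac]) auto
  have ae: "AE x in lborel. indicator (ball 0 1) x *\<^sub>R F x = indicator (ball 0 1) x *\<^sub>R ?S x"
    using AE_G AE_lborel_singleton[of 0]
    by eventually_elim (auto simp: F_def vfield_radial_jac indicator_def)
  have [measurable]: "ball (0::real^2) 1 \<in> sets borel" by simp
  have [measurable]: "(\<lambda>x::real^2. x /\<^sub>R norm x) \<in> borel_measurable borel"
    by measurable
  have [measurable]: "(\<lambda>x. matrix (frechet_derivative \<phi> (at x))) \<in> borel_measurable borel"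
    unfolding matrix_def
    by (intro borel_measurable_continuous_onI continuous_on_vec_lambda
        bounded_linear.continuous_on[OF bounded_linear_vec_nth] test_funD(5)[OF tf])
  have G_meas: "(\<lambda>x. indicator (ball 0 1) x *\<^sub>R G x) \<in> borel_measurable borel"
    using G(2) by (simp add: Lp_on_def set_borel_measurable_def)
  have [measurable]: "(\<lambda>x. vfield p c k (direction (x /\<^sub>R norm x)) (indicator (ball 0 1) x *\<^sub>R G x)) \<in> borel_measurable borel"
    by (rule borel_measurable_vfield_direction[OF _ G_meas]) measurable
  \<comment> \<open>The indicator is inserted inside the field to reach a measurable argument, and
    it is also kept outside because the field need not vanish at the zero matrix.\<close>
  have F_eq: "(\<lambda>x. indicator (ball 0 1) x *\<^sub>R F x) = (\<lambda>x. indicator (ball 0 1) x *\<^sub>R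
      (vfield p c k (direction (x /\<^sub>R norm x)) (indicator (ball 0 1) x *\<^sub>R G x)
        \<bullet> matrix (frechet_derivative \<phi> (at x))))"
    by (auto simp: F_def indicator_def)
  have F_meas: "(\<lambda>x. indicator (ball 0 1) x *\<^sub>R F x) \<in> borel_measurable lborel"
    unfolding F_eq by measurable
  have S_int: "integrable lborel (\<lambda>x. indicator (ball 0 1) x *\<^sub>R ?S x)"
    using flux_weakly_divergence_free(1)[OF p c tf] by (simp add: set_integrable_def)
  show "set_integrable lborel (ball 0 1) F"
    unfolding set_integrable_def
    using integrable_cong_AE[OF F_meas borel_measurable_integrable[OF S_int] ae] S_int by simp
  show "(LINT x:ball 0 1|lborel. F x) = 0"
    using integral_cong_AE[OF F_meas borel_measurable_integrable[OF S_int] ae]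
      flux_weakly_divergence_free(2)[OF p c tf] by (simp add: set_lebesgue_integral_def)
qed

lemma radial_Lp_Linf:
  assumes "0 \<le> p"
  shows "Lp_on p (ball 0 1) (\<lambda>x::real^2. x /\<^sub>R norm x)" "Linf_on (ball 0 1) (\<lambda>x::real^2. x /\<^sub>R norm x)"
proof -
  have b: "norm (x /\<^sub>R norm x) \<le> 1" for x :: "real^2" by (cases "x = 0") auto
  have m: "set_borel_measurable lborel (ball 0 1) (\<lambda>x::real^2. x /\<^sub>R norm x)"
    by (intro set_borel_measurable_punctured continuous_on_radial) auto
  have [measurable]: "ball (0::real^2) 1 \<in> sets borel" by simp
  have "set_borel_measurable lborel (ball 0 1) (\<lambda>x::real^2. norm (x /\<^sub>R norm x) powr p)"
    unfolding set_borel_measurable_def by measurable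
  moreover have "\<bar>norm (x /\<^sub>R norm x) powr p\<bar> \<le> 1" for x :: "real^2"
    using powr_mono2[OF assms norm_ge_zero b, of x] by (simp only: abs_of_nonneg[OF powr_ge_zero] powr_one_eq_one)
  ultimately have "set_integrable lborel (ball 0 1) (\<lambda>x::real^2. norm (x /\<^sub>R norm x) powr p)"
    by (intro set_integrable_bounded[of _ _ 1]) auto
  with m show "Lp_on p (ball 0 1) (\<lambda>x::real^2. x /\<^sub>R norm x)"
    unfolding Lp_on_def by blast
  show "Linf_on (ball 0 1) (\<lambda>x::real^2. x /\<^sub>R norm x)"
    unfolding Linf_on_def using m b by blast
qed

text \<open>\<open>Du\<close> is rendered as an arbitrary weak Jacobian in \<open>Lp_on p B\<close>,
  so the equation does not hinge on a chosen representative. Integrability is asserted alongside the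
  vanishing integral because a nonintegrable function has integral 0 by convention.\<close>

theorem theorem1p3:
  fixes p :: real
  assumes "1 < p" "p < 2"
  defines "B \<equiv> ball (0::real^2) 1"
  defines "u \<equiv> (\<lambda>x::real^2. x /\<^sub>R norm x)"
  shows "sobolev_W1p p B u \<and> Linf_on B u \<and>
    (\<exists>(a :: real^2 \<Rightarrow> real^2^2 \<Rightarrow> real^2^2) (Da :: real^2 \<Rightarrow> real^2^2 \<Rightarrow> ((real^2^2) \<Rightarrow>\<^sub>L (real^2^2))) L \<nu>.
       0 < \<nu> \<and> \<nu> \<le> L \<and>
       (\<forall>v z. ((\<lambda>z. a v z) has_derivative blinfun_apply (Da v z)) (at z)) \<and>
       (\<forall>v. continuous_on UNIV (Da v)) \<and>
       (\<forall>v z. norm (a v z) + norm (Da v z) * (1 + norm z) \<le> L * (1 + norm z) powr (p - 1)) \<and>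
       (\<forall>v z l. \<nu> * (1 + norm z) powr (p - 2) * (norm l)\<^sup>2 \<le> (blinfun_apply (Da v z) l) \<bullet> l) \<and>
       (\<forall>\<alpha>. 0 < \<alpha> \<and> \<alpha> < 1 \<longrightarrow> (\<forall>v w z.
          norm (a v z - a w z) \<le> L * (1 + norm z) powr (p - 1) * min 1 (norm (v - w) powr \<alpha>))) \<and>
       (\<forall>G. weak_jacobian B u G \<and> Lp_on p B G \<longrightarrow>
          (\<forall>\<phi>::real^2 \<Rightarrow> real^2. test_fun B \<phi> \<longrightarrow>
             set_integrable lborel B (\<lambda>x. a (u x) (G x) \<bullet> matrix (frechet_derivative \<phi> (at x))) \<and>
             (LINT x:B|lborel. a (u x) (G x) \<bullet> matrix (frechet_derivative \<phi> (at x))) = 0)))"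
proof -
  \<comment> \<open>\<open>c\<close> is dictated by zero divergence, and \<open>k\<close> is the
    least value that the ellipticity estimate admits for it.\<close>
  define c where "c = 1 / (2 - p)"
  define k where "k = 4 * c\<^sup>2"
  define a where "a v z = vfield p c k (direction v) z" for v :: "real^2" and z
  define Da where "Da v z = vfield_deriv p c k (direction v) z" for v :: "real^2" and z
  \<comment> \<open>Twice the Lipschitz constant of the field in \<open>N\<close>, the 2 being the
    Hoelder constant of \<open>direction\<close>. In \<open>\<nu>\<close>,
    \<open>(p - 1) / 2\<close> is the ellipticity left after the cross term, and the power of
    \<open>1 + k\<close> undoes the stretching inside \<open>max 1\<close>.\<close>
  define L where "L = 2 * (10 + 3 * c) * (1 + k)\<^sup>2"
  define \<nu> where "\<nu> = (p - 1) / 2 * (1 + k) powr ((p - 2) / 2)"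
  note p = assms(1,2)
  have c: "c \<ge> 0" and k: "k \<ge> 0" using p by (auto simp: c_def k_def)
  have sq: "1 + k \<le> (1 + k)\<^sup>2" "1 \<le> (1 + k)\<^sup>2"
    using k by (auto simp: power2_eq_square algebra_simps)
  have "sobolev_W1p p B u"
    unfolding sobolev_W1p_def B_def u_def
    using p radial_Lp_Linf(1)[of p] weak_jacobian_radial Lp_on_radial_jac[OF p] by auto
  moreover have "Linf_on B u"
    unfolding B_def u_def by (rule radial_Lp_Linf(2)[of 1]) simp
  moreover have "0 < \<nu>"
    using p k by (simp add: \<nu>_def)
  moreover have "\<nu> \<le> L"
  proof -
    have "(1 + k) powr ((p - 2) / 2) \<le> (1 + k) powr 0"
      using p k by (intro powr_mono) auto
    then have "\<nu> \<le> 1 * 1"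
      unfolding \<nu>_def using p k by (intro mult_mono) auto
    also have "\<dots> \<le> L"
      unfolding L_def using sq c mult_mono[of 1 "2 * (10 + 3 * c)" 1 "(1 + k)\<^sup>2"] by simp
    finally show ?thesis .
  qed
  moreover have "\<forall>v z. ((\<lambda>z. a v z) has_derivative blinfun_apply (Da v z)) (at z)"
    unfolding a_def Da_def by (intro allI vfield_has_derivative)
  moreover have "\<forall>v. continuous_on UNIV (Da v)"
    unfolding Da_def[abs_def] by (intro allI continuous_on_vfield_deriv)
  moreover have "\<forall>v z. norm (a v z) + norm (Da v z) * (1 + norm z) \<le> L * (1 + norm z) powr (p - 1)"
  proof (intro allI)
    fix v :: "real^2" and z :: "real^2^2"
    have "norm (a v z) + norm (Da v z) * (1 + norm z)
        \<le> (4 + c) * (1 + k) * (1 + norm z) powr (p - 1) + 2 * (3 + c) * (1 + k)\<^sup>2 * (1 + norm z) powr (p - 1)"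
      unfolding a_def Da_def
      by (intro add_mono vfield_growth vfield_deriv_growth p c k norm_direction_le)
    also have "\<dots> = ((4 + c) * (1 + k) + 2 * (3 + c) * (1 + k)\<^sup>2) * (1 + norm z) powr (p - 1)"
      by (simp add: distrib_right)
    also have "\<dots> \<le> L * (1 + norm z) powr (p - 1)"
    proof (rule mult_right_mono)
      \<comment> \<open>After this replacement the growth constants add up to
        \<open>(10 + 3 * c) * (1 + k)^2\<close>, exactly half of \<open>L\<close>.\<close>
      have "(4 + c) * (1 + k) \<le> (4 + c) * (1 + k)\<^sup>2"
        using sq c by (intro mult_left_mono) auto
      moreover have "0 \<le> (10 + 3 * c) * (1 + k)\<^sup>2" using c by simp
      ultimately show "(4 + c) * (1 + k) + 2 * (3 + c) * (1 + k)\<^sup>2 \<le> L"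
        unfolding L_def by (simp add: algebra_simps)
    qed simp
    finally show "norm (a v z) + norm (Da v z) * (1 + norm z) \<le> L * (1 + norm z) powr (p - 1)" .
  qed
  moreover have "\<forall>v z l. \<nu> * (1 + norm z) powr (p - 2) * (norm l)\<^sup>2 \<le> (blinfun_apply (Da v z) l) \<bullet> l"
  proof (intro allI)
    fix v :: "real^2" and z l :: "real^2^2"
    have "\<nu> * (1 + norm z) powr (p - 2) * (norm l)\<^sup>2
        = (p - 1) / 2 * ((1 + k) powr ((p - 2) / 2) * (1 + norm z) powr (p - 2)) * (norm l)\<^sup>2"
      by (simp add: \<nu>_def)
    also have "\<dots> \<le> (p - 1) / 2 * max 1 (stretch_sq k (direction v) z) powr ((p - 2) / 2) * stretch_sq k (direction v) l"
      using p by (intro mult_mono mult_left_mono max_stretch_sq_powr_ge p k norm_direction_le stretch_sq_ge) auto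
    also have "\<dots> \<le> blinfun_apply (Da v z) l \<bullet> l"
      unfolding Da_def by (rule vfield_deriv_elliptic[OF p c]) (simp add: k_def)
    finally show "\<nu> * (1 + norm z) powr (p - 2) * (norm l)\<^sup>2 \<le> (blinfun_apply (Da v z) l) \<bullet> l" .
  qed
  moreover have "\<forall>\<alpha>. 0 < \<alpha> \<and> \<alpha> < 1 \<longrightarrow> (\<forall>v w z.
      norm (a v z - a w z) \<le> L * (1 + norm z) powr (p - 1) * min 1 (norm (v - w) powr \<alpha>))"
  proof (intro allI impI)
    fix \<alpha> :: real and v w :: "real^2" and z :: "real^2^2" assume \<alpha>: "0 < \<alpha> \<and> \<alpha> < 1"
    have "norm (a v z - a w z)
        \<le> (10 + 3 * c) * (1 + k)\<^sup>2 * (1 + norm z) powr (p - 1) * norm (direction v - direction w)"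
      unfolding a_def by (intro vfield_Lipschitz p c k norm_direction_le)
    also have "\<dots> \<le> (10 + 3 * c) * (1 + k)\<^sup>2 * (1 + norm z) powr (p - 1) * (2 * min 1 (norm (v - w) powr \<alpha>))"
      using \<alpha> c by (intro mult_left_mono direction_Hoelder) auto
    also have "\<dots> = L * (1 + norm z) powr (p - 1) * min 1 (norm (v - w) powr \<alpha>)"
      unfolding L_def by (simp only: mult_ac)
    finally show "norm (a v z - a w z) \<le> L * (1 + norm z) powr (p - 1) * min 1 (norm (v - w) powr \<alpha>)" .
  qed
  moreover have "\<forall>G. weak_jacobian B u G \<and> Lp_on p B G \<longrightarrow>
      (\<forall>\<phi>::real^2 \<Rightarrow> real^2. test_fun B \<phi> \<longrightarrow>
        set_integrable lborel B (\<lambda>x. a (u x) (G x) \<bullet> matrix (frechet_derivative \<phi> (at x))) \<and>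
        (LINT x:B|lborel. a (u x) (G x) \<bullet> matrix (frechet_derivative \<phi> (at x))) = 0)"
    unfolding a_def B_def u_def using vfield_weak_solution[OF p c_def] by blast
  ultimately show ?thesis by blast
qed

end
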